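(* Let $(\mathbf B,\widehat E)\in C^1([0,T],H(\mathrm{div};\Omega))\times C([0,T],H_0(\mathbf{rot};\Omega))$ solve $$\Big(\frac{\partial\mathbf B}{\partial t},\mathbf w\Big)+(\mathbf{rot}\,E,\mathbf w)=0\quad\forall\mathbf w\in H(\mathrm{div};\Omega),$$ $$(\sigma\widehat E,v)+(\sigma\,\mathbf u\times\mathbf B,v)-(\mathbf B,\mathbf{rot}\,v)=-(\sigma E_0,v)\quad\forall v\in H_0(\mathbf{rot};\Omega),$$ with $E=\widehat E+E_0$, $\mathbf B(\cdot,0)=\mathbf B^0$, $\mathrm{div}\,\mathbf B^0=0$. Then $$\frac{d}{dt}\|\mathbf B\|_{0,\Omega}^2+\frac12\|\sigma^{1/2}\widehat E\|_{0,\Omega}^2\le\|E_0\|_{H_\sigma(\mathbf{rot};\Omega)}^2+\big(2(\sigma^* )^2\|\mathbf u\|_\infty^2+1\big)\|\mathbf B\|_{0,\Omega}^2,$$ where $\|E\|_{H_\sigma(\mathbf{rot};\Omega)}^2=\|\sigma^{1/2}E\|_{0,\Omega}^2+\|\mathbf{rot}\,E\|_{0,\Omega}^2$. As a consequence, there exists a bounded function $\beta:[0,T]\to\mathbb R^+$ such that $$\beta(t)\|\mathbf B(\cdot,t)\|_{0,\Omega}^2+\frac12\int_0^t\beta(\tau)\|\sigma^{1/2}\widehat E(\cdot,\tau)\|_{0,\Omega}^2\,d\tau\le\int_0^t\beta(\tau)\|E_0(\cdot,\tau)\|_{H_\sigma(\mathbf{rot};\Omega)}^2\,d\tau+\|\mathbf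 B^0\|_{0,\Omega}^2.$$
   Context: $\Omega\subset\mathbb R^2$ is open, bounded, polygonal, $T>0$; $(\cdot,\cdot)$ and $\|\cdot\|_{0,\Omega}$ are the $L^2(\Omega)$ inner product and norm. For a scalar $v$, $\mathbf{rot}\,v=(\partial_yv,-\partial_xv)^T$, and $\mathbf u\times\mathbf B=u_xB_y-u_yB_x$. $H(\mathrm{div};\Omega)=\{\mathbf w\in L^2(\Omega)^2:\mathrm{div}\,\mathbf w\in L^2(\Omega)\}$, $H(\mathbf{rot};\Omega)=\{v\in L^2(\Omega):\mathbf{rot}\,v\in L^2(\Omega)^2\}$, and $H_0(\mathbf{rot};\Omega)$ is its subspace of functions vanishing on $\partial\Omega$. The velocity $\mathbf u\in[L^\infty(\Omega)]^2$ is given, with $\|\mathbf u\|_\infty$ its $L^\infty$ norm; $\sigma$ (the reciprocal of the resistivity) is a given function on $\Omega$ with positive constants $\sigma_*\le\sigma(\mathbf x)\le\sigma^*$ for almost every $\mathbf x\in\Omega$. $E_0$ is a known function through which the boundary conditions on the electric field $E$ are set.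
   Formalization: The first inequality is false as written for some σ* < 1; it is proved with 2σ*‖u‖²+1 in place of 2(σ* )²‖u‖²+1 for every σ*, and with the original constant when σ* ≥ 1. The integrated inequality assumes ‖E_0‖² in H_σ(rot) is integrable in time. *)

theory Defs
  imports "HOL-Analysis.Analysis" "HOL-Probability.Essential_Supremum"
begin

(* Elements of Lebesgue and Sobolev spaces are represented by functions on the whole plane, of
   which only the restriction to Omega, up to null sets, matters. *)

type_synonym scalar_field = "real^2 \<Rightarrow> real"
type_synonym vector_field = "real^2 \<Rightarrow> real^2"

(* Slit domains are allowed. *)
definition polygonal :: "(real^2) set \<Rightarrow> bool" where
  "polygonal \<Omega> \<longleftrightarrow>
     (\<exists>S. finite S \<and> frontier \<Omega> = (\<Union>(a, b)\<in>S. closed_segment a b))"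

definition L2 :: "(real^2) set \<Rightarrow> (real^2 \<Rightarrow> 'b::euclidean_space) set" where
  "L2 \<Omega> = {f. f \<in> borel_measurable (lebesgue_on \<Omega>) \<and>
              integrable (lebesgue_on \<Omega>) (\<lambda>x. (norm (f x))\<^sup>2)}"

definition L2_inner ::
    "(real^2) set \<Rightarrow> (real^2 \<Rightarrow> 'b::euclidean_space) \<Rightarrow> (real^2 \<Rightarrow> 'b) \<Rightarrow> real" where
  "L2_inner \<Omega> f g = (LINT x|lebesgue_on \<Omega>. f x \<bullet> g x)"

definition L2_norm :: "(real^2) set \<Rightarrow> (real^2 \<Rightarrow> 'b::euclidean_space) \<Rightarrow> real" where
  "L2_norm \<Omega> f = sqrt (L2_inner \<Omega> f f)"

definition Linf :: "(real^2) set \<Rightarrow> (real^2 \<Rightarrow> 'b::euclidean_space) set" where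
  "Linf \<Omega> = {f. f \<in> borel_measurable (lebesgue_on \<Omega>) \<and>
                (\<exists>C. AE x in lebesgue_on \<Omega>. norm (f x) \<le> C)}"

(* The pointwise norm is the Euclidean one. *)
definition Linf_norm :: "(real^2) set \<Rightarrow> (real^2 \<Rightarrow> 'b::euclidean_space) \<Rightarrow> real" where
  "Linf_norm \<Omega> f = real_of_ereal (esssup (lebesgue_on \<Omega>) (\<lambda>x. ereal (norm (f x))))"

definition partial :: "2 \<Rightarrow> scalar_field \<Rightarrow> scalar_field" where
  "partial i f x = frechet_derivative f (at x) (axis i 1)"

(* For k > 0 only differentiability is demanded besides the condition on the partial derivatives;
   since the latter are continuous at the bottom of the recursion, this is the usual class C^k. *)
primrec Ck :: "nat \<Rightarrow> scalar_field \<Rightarrow> bool" where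
  "Ck 0 f \<longleftrightarrow> continuous_on UNIV f"
| "Ck (Suc k) f \<longleftrightarrow> (\<forall>x. f differentiable (at x)) \<and> (\<forall>i. Ck k (partial i f))"

definition test_functions :: "(real^2) set \<Rightarrow> scalar_field set" where
  "test_functions \<Omega> = {\<phi>. (\<forall>k. Ck k \<phi>) \<and> compact (closure {x. \<phi> x \<noteq> 0}) \<and>
                            closure {x. \<phi> x \<noteq> 0} \<subseteq> \<Omega>}"

definition grad :: "scalar_field \<Rightarrow> vector_field" where
  "grad \<phi> x = vector [partial 1 \<phi> x, partial 2 \<phi> x]"

definition classical_rot :: "scalar_field \<Rightarrow> vector_field" where
  "classical_rot \<phi> x = vector [partial 2 \<phi> x, - partial 1 \<phi> x]"

definition cross2 :: "real^2 \<Rightarrow> real^2 \<Rightarrow> real" where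
  "cross2 a b = a$1 * b$2 - a$2 * b$1"

definition is_weak_div :: "(real^2) set \<Rightarrow> vector_field \<Rightarrow> scalar_field \<Rightarrow> bool" where
  "is_weak_div \<Omega> w d \<longleftrightarrow> d \<in> L2 \<Omega> \<and>
     (\<forall>\<phi>\<in>test_functions \<Omega>. L2_inner \<Omega> w (grad \<phi>) = - L2_inner \<Omega> d \<phi>)"

definition is_weak_rot :: "(real^2) set \<Rightarrow> scalar_field \<Rightarrow> vector_field \<Rightarrow> bool" where
  "is_weak_rot \<Omega> v r \<longleftrightarrow> r \<in> L2 \<Omega> \<and>
     (\<forall>\<phi>\<in>test_functions \<Omega>.
        (LINT x|lebesgue_on \<Omega>. v x *\<^sub>R classical_rot \<phi> x) = - (LINT x|lebesgue_on \<Omega>. \<phi> x *\<^sub>R r x))"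

(* Weak derivatives are unique up to null sets; weak_div and weak_rot pick representatives. *)
definition weak_div :: "(real^2) set \<Rightarrow> vector_field \<Rightarrow> scalar_field" where
  "weak_div \<Omega> w = (SOME d. is_weak_div \<Omega> w d)"

definition weak_rot :: "(real^2) set \<Rightarrow> scalar_field \<Rightarrow> vector_field" where
  "weak_rot \<Omega> v = (SOME r. is_weak_rot \<Omega> v r)"

definition Hdiv :: "(real^2) set \<Rightarrow> vector_field set" where
  "Hdiv \<Omega> = {w\<in>L2 \<Omega>. \<exists>d. is_weak_div \<Omega> w d}"

definition Hdiv_norm :: "(real^2) set \<Rightarrow> vector_field \<Rightarrow> real" where
  "Hdiv_norm \<Omega> w = sqrt ((L2_norm \<Omega> w)\<^sup>2 + (L2_norm \<Omega> (weak_div \<Omega> w))\<^sup>2)"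

definition Hrot :: "(real^2) set \<Rightarrow> scalar_field set" where
  "Hrot \<Omega> = {v\<in>L2 \<Omega>. \<exists>r. is_weak_rot \<Omega> v r}"

definition Hrot_norm :: "(real^2) set \<Rightarrow> scalar_field \<Rightarrow> real" where
  "Hrot_norm \<Omega> v = sqrt ((L2_norm \<Omega> v)\<^sup>2 + (L2_norm \<Omega> (weak_rot \<Omega> v))\<^sup>2)"

(* Vanishing on the boundary is meant in the usual sense: H_0(rot) is the closure of the test
   functions in H(rot). *)
definition Hrot0 :: "(real^2) set \<Rightarrow> scalar_field set" where
  "Hrot0 \<Omega> = {v\<in>Hrot \<Omega>. \<exists>\<phi>. (\<forall>n. \<phi> n \<in> test_functions \<Omega>) \<and>
                (\<lambda>n::nat. Hrot_norm \<Omega> (\<lambda>x. v x - \<phi> n x)) \<longlonglongrightarrow> 0}"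

definition Hrot_weighted_norm :: "scalar_field \<Rightarrow> (real^2) set \<Rightarrow> scalar_field \<Rightarrow> real" where
  "Hrot_weighted_norm \<sigma> \<Omega> v =
     sqrt ((L2_norm \<Omega> (\<lambda>x. sqrt (\<sigma> x) * v x))\<^sup>2 + (L2_norm \<Omega> (weak_rot \<Omega> v))\<^sup>2)"

(* C([0,T], X) for a space X of functions with (semi)norm N. *)
definition C0_time ::
    "real \<Rightarrow> (real^2 \<Rightarrow> 'b::euclidean_space) set \<Rightarrow> ((real^2 \<Rightarrow> 'b) \<Rightarrow> real) \<Rightarrow>
     (real \<Rightarrow> real^2 \<Rightarrow> 'b) \<Rightarrow> bool" where
  "C0_time T X N f \<longleftrightarrow> (\<forall>t\<in>{0..T}. f t \<in> X) \<and>
     (\<forall>t\<in>{0..T}. ((\<lambda>s. N (\<lambda>x. f s x - f t x)) \<longlongrightarrow> 0) (at t within {0..T}))"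

(* f belongs to C^1([0,T], X) with time derivative f'. *)
definition C1_time ::
    "real \<Rightarrow> (real^2 \<Rightarrow> 'b::euclidean_space) set \<Rightarrow> ((real^2 \<Rightarrow> 'b) \<Rightarrow> real) \<Rightarrow>
     (real \<Rightarrow> real^2 \<Rightarrow> 'b) \<Rightarrow> (real \<Rightarrow> real^2 \<Rightarrow> 'b) \<Rightarrow> bool" where
  "C1_time T X N f f' \<longleftrightarrow> C0_time T X N f \<and> C0_time T X N f' \<and>
     (\<forall>t\<in>{0..T}.
        ((\<lambda>s. N (\<lambda>x. (f s x - f t x) /\<^sub>R (s - t) - f' t x)) \<longlongrightarrow> 0) (at t within {0..T}))"

definition is_solution ::
    "(real^2) set \<Rightarrow> real \<Rightarrow> scalar_field \<Rightarrow> vector_field \<Rightarrow> (real \<Rightarrow> scalar_field) \<Rightarrow>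
     vector_field \<Rightarrow> (real \<Rightarrow> vector_field) \<Rightarrow> (real \<Rightarrow> scalar_field) \<Rightarrow> bool" where
  "is_solution \<Omega> T \<sigma> u E0 B0 B Ehat \<longleftrightarrow>
     C0_time T (Hrot0 \<Omega>) (Hrot_norm \<Omega>) Ehat \<and>
     (\<forall>t\<in>{0..T}. E0 t \<in> Hrot \<Omega>) \<and>
     (\<exists>B'. C1_time T (Hdiv \<Omega>) (Hdiv_norm \<Omega>) B B' \<and>
        (\<forall>t\<in>{0..T}. \<forall>w\<in>Hdiv \<Omega>.
           L2_inner \<Omega> (B' t) w + L2_inner \<Omega> (weak_rot \<Omega> (\<lambda>x. Ehat t x + E0 t x)) w = 0)) \<and>
     (\<forall>t\<in>{0..T}. \<forall>v\<in>Hrot0 \<Omega>.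
        L2_inner \<Omega> (\<lambda>x. \<sigma> x * Ehat t x) v + L2_inner \<Omega> (\<lambda>x. \<sigma> x * cross2 (u x) (B t x)) v
          - L2_inner \<Omega> (B t) (weak_rot \<Omega> v)
        = - L2_inner \<Omega> (\<lambda>x. \<sigma> x * E0 t x) v) \<and>
     (AE x in lebesgue_on \<Omega>. B 0 x = B0 x) \<and>
     is_weak_div \<Omega> B0 (\<lambda>x. 0)"

(* On the constant in the energy inequality, with s an upper bound of sigma: testing with B and
   Ehat gives the constant 2 s |u|^2 + 1.  For s >= 1 it is at most 2 s^2 |u|^2 + 1, but for s < 1
   the inequality with 2 s^2 |u|^2 + 1 can fail.  Example: Omega = (-L,L)^2 with L = 1000,
   sigma = s = 1/100, u = (-x,0), B = (0,e^t), E = e^t x,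
   Ehat = 4 e^t x (1 - x^2/L^2) (1 - y^2/L^2), E0 = E - Ehat. *)

end

theory Submission
  imports Defs
begin

text \<open>
  Both estimates are consequences of one energy identity. Faraday's law may be tested with \<open>B t\<close> and
  Ohm's law with \<open>Ehat t\<close>. In their combination the coupling terms \<open>(rot Ehat, B)\<close> cancel, and
  Young's inequality absorbs everything that contains \<open>Ehat\<close> into the dissipation
  \<open>\<parallel>\<sigma>\<^sup>1\<^sup>/\<^sup>2 Ehat\<parallel>\<^sup>2\<close>; see \<open>energy_inequality\<close>. Since the time derivative of \<open>\<parallel>B\<parallel>\<^sup>2\<close> is \<open>2 (B', B)\<close>
  (\<open>L2_norm_squared_has_derivative\<close>), this is the differential inequality, with the constant
  \<open>K = 2 \<sigma>\<^sup>* \<parallel>u\<parallel>\<^sup>2 + 1\<close>. When \<open>\<sigma>\<^sup>* \<ge> 1\<close>, replacing \<open>\<sigma>\<^sup>*\<close> by its square only increases \<open>K\<close>.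

  For the integrated estimate the weight is \<open>\<beta> t = exp (- K t)\<close>, the integrating factor that removes the
  term \<open>K \<parallel>B\<parallel>\<^sup>2\<close>; see \<open>integrating_factor_inequality\<close>. It depends only on \<open>\<sigma>\<^sup>*\<close> and \<open>u\<close>, hence
  serves all solutions at once.

  The cancellation needs \<open>rot (Ehat + E0) = rot Ehat + rot E0\<close> for weak rotations that are chosen
  representatives. This rests on the uniqueness of weak derivatives, that is, on the fundamental lemma
  of the calculus of variations. It is proved by approximating indicators of boxes by explicit smooth
  functions built from \<open>exp (- 1 / x)\<close>, followed by a Dynkin system argument.
\<close>

section \<open>Square integrable functions\<close>

lemma integrable_bound_everywhere:
  fixes f :: "'a \<Rightarrow> 'b::{banach, second_countable_topology}"
  assumes "f \<in> borel_measurable M" "\<And>x. norm (f x) \<le> g x" "integrable M g"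
  shows "integrable M f"
proof (rule Bochner_Integration.integrable_bound[OF assms(3,1)])
  show "AE x in M. norm (f x) \<le> norm (g x)"
    using assms(2) by (intro AE_I2) (metis abs_ge_self order_trans real_norm_def)
qed

text \<open>
  The two functions may take values in different spaces; the cross product term is compared with the
  vector field \<open>B\<close> in this way.
\<close>

lemma L2_dominated:
  fixes f :: "real^2 \<Rightarrow> 'b::euclidean_space" and g :: "real^2 \<Rightarrow> 'c::euclidean_space"
  assumes f: "f \<in> borel_measurable (lebesgue_on \<Omega>)" and g: "g \<in> L2 \<Omega>"
    and le: "AE x in lebesgue_on \<Omega>. norm (f x) \<le> C * norm (g x)"
  shows "f \<in> L2 \<Omega>"
proof -
  have "integrable (lebesgue_on \<Omega>) (\<lambda>x. C\<^sup>2 * (norm (g x))\<^sup>2)"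
    using g by (simp add: L2_def)
  then have "integrable (lebesgue_on \<Omega>) (\<lambda>x. (norm (f x))\<^sup>2)"
  proof (rule Bochner_Integration.integrable_bound)
    show "(\<lambda>x. (norm (f x))\<^sup>2) \<in> borel_measurable (lebesgue_on \<Omega>)"
      using f by measurable
    show "AE x in lebesgue_on \<Omega>. norm ((norm (f x))\<^sup>2) \<le> norm (C\<^sup>2 * (norm (g x))\<^sup>2)"
      using le by eventually_elim (simp add: power_mono flip: power_mult_distrib)
  qed
  with f show ?thesis by (simp add: L2_def)
qed

lemma L2_scaleR: "f \<in> L2 \<Omega> \<Longrightarrow> (\<lambda>x. c *\<^sub>R f x) \<in> L2 \<Omega>"
  by (rule L2_dominated[of _ _ f "\<bar>c\<bar>"]) (auto simp: L2_def)

lemma L2_add: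
  assumes "f \<in> L2 \<Omega>" "g \<in> L2 \<Omega>" shows "(\<lambda>x. f x + g x) \<in> L2 \<Omega>"
proof -
  have [measurable]: "f \<in> borel_measurable (lebesgue_on \<Omega>)" "g \<in> borel_measurable (lebesgue_on \<Omega>)"
    using assms by (auto simp: L2_def)
  have "norm ((norm (f x + g x))\<^sup>2) \<le> 2 * ((norm (f x))\<^sup>2 + (norm (g x))\<^sup>2)" for x
  proof -
    have "(norm (f x + g x))\<^sup>2 \<le> (norm (f x) + norm (g x))\<^sup>2"
      by (intro power_mono norm_triangle_ineq norm_ge_zero)
    then show ?thesis
      using sum_squares_bound[of "norm (f x)" "norm (g x)"] by (simp add: power2_sum)
  qed
  moreover have "integrable (lebesgue_on \<Omega>) (\<lambda>x. 2 * ((norm (f x))\<^sup>2 + (norm (g x))\<^sup>2))"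
    using assms by (auto simp: L2_def)
  ultimately have "integrable (lebesgue_on \<Omega>) (\<lambda>x. (norm (f x + g x))\<^sup>2)"
    by (rule integrable_bound_everywhere[rotated]) measurable
  then show ?thesis by (simp add: L2_def)
qed

lemma L2_diff: "f \<in> L2 \<Omega> \<Longrightarrow> g \<in> L2 \<Omega> \<Longrightarrow> (\<lambda>x. f x - g x) \<in> L2 \<Omega>"
  using L2_add[of f \<Omega> "\<lambda>x. (-1) *\<^sub>R g x"] L2_scaleR[of g \<Omega> "-1"] by simp

lemma L2_mult_essentially_bounded:
  assumes "s \<in> borel_measurable (lebesgue_on \<Omega>)" "AE x in lebesgue_on \<Omega>. \<bar>s x\<bar> \<le> C" "f \<in> L2 \<Omega>"
  shows "(\<lambda>x. s x *\<^sub>R f x) \<in> L2 \<Omega>"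
proof (rule L2_dominated)
  show "(\<lambda>x. s x *\<^sub>R f x) \<in> borel_measurable (lebesgue_on \<Omega>)"
    using assms by (auto simp: L2_def)
  show "AE x in lebesgue_on \<Omega>. norm (s x *\<^sub>R f x) \<le> C * norm (f x)"
    using assms(2) by eventually_elim (simp add: mult_right_mono)
qed fact

lemma L2_bounded_continuous:
  fixes f :: "real^2 \<Rightarrow> 'b::euclidean_space"
  assumes "open \<Omega>" "bounded \<Omega>" "continuous_on UNIV f"
  shows "f \<in> L2 \<Omega>"
proof -
  have "compact (f ` closure \<Omega>)"
    using assms by (intro compact_continuous_image continuous_on_subset[OF assms(3)]) (auto simp: compact_closure)
  then obtain C where C: "\<And>x. x \<in> closure \<Omega> \<Longrightarrow> norm (f x) \<le> C"
    using compact_imp_bounded bounded_iff by (metis imageI)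
  have "finite_measure (lebesgue_on \<Omega>)"
    using assms by (intro finite_measure_lebesgue_on bounded_set_imp_lmeasurable) auto
  then have "(\<lambda>x. 1 :: real) \<in> L2 \<Omega>"
    by (simp add: L2_def finite_measure.integrable_const)
  moreover have "f \<in> borel_measurable (lebesgue_on \<Omega>)"
    using assms by (intro measurable_restrict_space1 measurable_completion) (simp add: borel_measurable_continuous_onI)
  moreover have "AE x in lebesgue_on \<Omega>. norm (f x) \<le> C * norm (1::real)"
    using C closure_subset by (intro AE_I2) (auto simp: space_restrict_space)
  ultimately show ?thesis
    using L2_dominated by blast
qed

lemma L2_imp_integrable:
  fixes f :: "real^2 \<Rightarrow> 'b::euclidean_space"
  assumes "open \<Omega>" "bounded \<Omega>" "f \<in> L2 \<Omega>"
  shows "integrable (lebesgue_on \<Omega>) f"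
proof -
  have "(\<lambda>x. 1 :: real) \<in> L2 \<Omega>"
    using assms by (intro L2_bounded_continuous) auto
  then have int: "integrable (lebesgue_on \<Omega>) (\<lambda>x. 1 + (norm (f x))\<^sup>2)"
    using assms(3) by (intro Bochner_Integration.integrable_add) (auto simp: L2_def)
  have le: "norm (f x) \<le> 1 + (norm (f x))\<^sup>2" for x
    using sum_squares_bound[of 1 "norm (f x)"] norm_ge_zero[of "f x"]
    unfolding power_one mult_1_right by linarith
  have "f \<in> borel_measurable (lebesgue_on \<Omega>)"
    using assms(3) by (simp add: L2_def)
  then show ?thesis
    by (rule integrable_bound_everywhere[OF _ le int])
qed

lemma integrable_L2_inner:
  fixes f g :: "real^2 \<Rightarrow> 'b::euclidean_space"
  assumes "f \<in> L2 \<Omega>" "g \<in> L2 \<Omega>" shows "integrable (lebesgue_on \<Omega>) (\<lambda>x. f x \<bullet> g x)"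
proof -
  have [measurable]: "f \<in> borel_measurable (lebesgue_on \<Omega>)" "g \<in> borel_measurable (lebesgue_on \<Omega>)"
    using assms by (auto simp: L2_def)
  have "norm (f x \<bullet> g x) \<le> (norm (f x))\<^sup>2 + (norm (g x))\<^sup>2" for x
    unfolding real_norm_def using Cauchy_Schwarz_ineq2[of "f x" "g x"] sum_squares_bound[of "norm (f x)" "norm (g x)"]
      mult_nonneg_nonneg[OF norm_ge_zero[of "f x"] norm_ge_zero[of "g x"]] by linarith
  moreover have "integrable (lebesgue_on \<Omega>) (\<lambda>x. (norm (f x))\<^sup>2 + (norm (g x))\<^sup>2)"
    using assms by (auto simp: L2_def)
  ultimately show ?thesis
    by (rule integrable_bound_everywhere[rotated]) measurable
qed

lemma integrable_L2_scaleR: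
  fixes g :: "real^2 \<Rightarrow> 'b::euclidean_space"
  assumes "f \<in> L2 \<Omega>" "g \<in> L2 \<Omega>" shows "integrable (lebesgue_on \<Omega>) (\<lambda>x. f x *\<^sub>R g x)"
proof -
  have int: "integrable (lebesgue_on \<Omega>) (\<lambda>x. (norm (f x))\<^sup>2 + (norm (g x))\<^sup>2)"
    using assms by (auto simp: L2_def)
  have le: "norm (f x *\<^sub>R g x) \<le> (norm (f x))\<^sup>2 + (norm (g x))\<^sup>2" for x
    using sum_squares_bound[of "norm (f x)" "norm (g x)"]
      mult_nonneg_nonneg[OF norm_ge_zero[of "f x"] norm_ge_zero[of "g x"]]
    unfolding norm_scaleR real_norm_def by linarith
  have "(\<lambda>x. f x *\<^sub>R g x) \<in> borel_measurable (lebesgue_on \<Omega>)"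
    using assms by (auto simp: L2_def)
  then show ?thesis
    by (rule integrable_bound_everywhere[OF _ le int])
qed

lemma L2_inner_commute: "L2_inner \<Omega> f g = L2_inner \<Omega> g f"
  by (simp add: L2_inner_def inner_commute)

lemma L2_inner_add_left:
  assumes "f \<in> L2 \<Omega>" "g \<in> L2 \<Omega>" "h \<in> L2 \<Omega>"
  shows "L2_inner \<Omega> (\<lambda>x. f x + g x) h = L2_inner \<Omega> f h + L2_inner \<Omega> g h"
  using assms by (simp add: L2_inner_def inner_add_left integrable_L2_inner)

lemma L2_inner_scaleR_left: "L2_inner \<Omega> (\<lambda>x. c *\<^sub>R f x) h = c * L2_inner \<Omega> f h"
  by (simp add: L2_inner_def)

lemma L2_inner_add_self:
  assumes "f \<in> L2 \<Omega>" "g \<in> L2 \<Omega>"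
  shows "L2_inner \<Omega> (\<lambda>x. f x + g x) (\<lambda>x. f x + g x)
    = L2_inner \<Omega> f f + 2 * L2_inner \<Omega> f g + L2_inner \<Omega> g g"
  using L2_inner_add_left[OF assms L2_add[OF assms]]
    L2_inner_add_left[OF assms assms(1)] L2_inner_add_left[OF assms assms(2)]
    L2_inner_commute[of \<Omega> f "\<lambda>x. f x + g x"] L2_inner_commute[of \<Omega> g "\<lambda>x. f x + g x"]
    L2_inner_commute[of \<Omega> g f]
  by linarith

lemma L2_inner_cong_AE:
  assumes "AE x in lebesgue_on \<Omega>. f x = f' x" "f \<in> L2 \<Omega>" "f' \<in> L2 \<Omega>" "g \<in> L2 \<Omega>"
  shows "L2_inner \<Omega> f g = L2_inner \<Omega> f' g"
  unfolding L2_inner_def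
proof (rule integral_cong_AE)
  show "AE x in lebesgue_on \<Omega>. f x \<bullet> g x = f' x \<bullet> g x"
    using assms(1) by eventually_elim simp
qed (use assms in \<open>auto simp: L2_def\<close>)

lemma L2_norm_squared: "(L2_norm \<Omega> f)\<^sup>2 = L2_inner \<Omega> f f"
  unfolding L2_norm_def L2_inner_def by (simp add: integral_nonneg_AE)

lemma L2_norm_nonneg: "0 \<le> L2_norm \<Omega> f"
  unfolding L2_norm_def L2_inner_def by (simp add: integral_nonneg_AE)

lemma L2_norm_squared_add_scaleR:
  assumes "f \<in> L2 \<Omega>" "g \<in> L2 \<Omega>"
  shows "(L2_norm \<Omega> (\<lambda>x. f x + c *\<^sub>R g x))\<^sup>2
    = (L2_norm \<Omega> f)\<^sup>2 + 2 * c * L2_inner \<Omega> g f + c\<^sup>2 * (L2_norm \<Omega> g)\<^sup>2"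
proof -
  have "L2_inner \<Omega> f (\<lambda>x. c *\<^sub>R g x) = c * L2_inner \<Omega> g f"
    by (metis L2_inner_commute L2_inner_scaleR_left)
  moreover have "L2_inner \<Omega> (\<lambda>x. c *\<^sub>R g x) (\<lambda>x. c *\<^sub>R g x) = c\<^sup>2 * L2_inner \<Omega> g g"
    by (metis L2_inner_commute L2_inner_scaleR_left mult.assoc power2_eq_square)
  ultimately show ?thesis
    using L2_inner_add_self[OF assms(1) L2_scaleR[OF assms(2), of c]]
    by (simp add: L2_norm_squared)
qed

text \<open>
  Young's inequality, with the weights distributed through \<open>c\<close>: expand \<open>0 \<le> \<parallel>g + c f\<parallel>\<^sup>2\<close>.
\<close>

lemma L2_Young:
  assumes "f \<in> L2 \<Omega>" "g \<in> L2 \<Omega>"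
  shows "- 2 * c * L2_inner \<Omega> f g \<le> c\<^sup>2 * (L2_norm \<Omega> f)\<^sup>2 + (L2_norm \<Omega> g)\<^sup>2"
  using L2_norm_squared_add_scaleR[OF assms(2,1), of c]
    zero_le_power2[of "L2_norm \<Omega> (\<lambda>x. g x + c *\<^sub>R f x)"]
  by linarith

text \<open>
  The quadratic polynomial \<open>t \<mapsto> \<parallel>f + t g\<parallel>\<^sup>2\<close> is nonnegative; evaluate it at its minimum, or far out
  when its leading coefficient vanishes.
\<close>

lemma L2_Cauchy_Schwarz:
  assumes "f \<in> L2 \<Omega>" "g \<in> L2 \<Omega>"
  shows "\<bar>L2_inner \<Omega> f g\<bar> \<le> L2_norm \<Omega> f * L2_norm \<Omega> g"
proof -
  let ?a = "L2_inner \<Omega> g g" and ?b = "L2_inner \<Omega> f g" and ?c = "L2_inner \<Omega> f f"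
  have pos: "0 \<le> ?c + 2 * t * ?b + t\<^sup>2 * ?a" for t
    using L2_norm_squared_add_scaleR[OF assms, of t] L2_inner_commute[of \<Omega> g f]
      zero_le_power2[of "L2_norm \<Omega> (\<lambda>x. f x + t *\<^sub>R g x)"]
    by (simp add: L2_norm_squared)
  have "?b\<^sup>2 \<le> ?c * ?a"
  proof (cases "?a = 0")
    case True
    have "?b = 0"
    proof (rule ccontr)
      assume "?b \<noteq> 0"
      \<comment> \<open>The polynomial is now affine in t; at this t it takes the value -1.\<close>
      with pos[of "- (?c + 1) / (2 * ?b)"] True show False by (simp add: field_simps)
    qed
    with True show ?thesis by simp
  next
    case False
    then have "0 < ?a"
      by (metis L2_norm_squared zero_le_power2 order_le_less)
    with pos[of "- ?b / ?a"] show ?thesis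
      by (simp add: field_simps power2_eq_square)
  qed
  then have "\<bar>?b\<bar>\<^sup>2 \<le> (L2_norm \<Omega> f * L2_norm \<Omega> g)\<^sup>2"
    by (simp add: power_mult_distrib L2_norm_squared)
  then show ?thesis
    by (rule power2_le_imp_le) (simp add: L2_norm_nonneg)
qed

lemma L2_norm_dominated:
  fixes f :: "real^2 \<Rightarrow> 'b::euclidean_space" and g :: "real^2 \<Rightarrow> 'c::euclidean_space"
  assumes f: "f \<in> L2 \<Omega>" and g: "g \<in> L2 \<Omega>" and "0 \<le> C"
    and le: "AE x in lebesgue_on \<Omega>. norm (f x) \<le> C * norm (g x)"
  shows "L2_norm \<Omega> f \<le> C * L2_norm \<Omega> g"
proof (rule power2_le_imp_le)
  have "L2_inner \<Omega> f f \<le> (LINT x|lebesgue_on \<Omega>. C\<^sup>2 * (g x \<bullet> g x))"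
    unfolding L2_inner_def
  proof (rule integral_mono_AE)
    show "AE x in lebesgue_on \<Omega>. f x \<bullet> f x \<le> C\<^sup>2 * (g x \<bullet> g x)"
      using le
    proof eventually_elim
      case (elim x)
      then have "(norm (f x))\<^sup>2 \<le> (C * norm (g x))\<^sup>2"
        by (rule power_mono) simp
      then show ?case by (simp add: power_mult_distrib power2_norm_eq_inner)
    qed
  qed (use integrable_L2_inner[OF f f] integrable_L2_inner[OF g g] in auto)
  then show "(L2_norm \<Omega> f)\<^sup>2 \<le> (C * L2_norm \<Omega> g)\<^sup>2"
    by (simp add: power_mult_distrib L2_norm_squared L2_inner_def)
qed (use \<open>0 \<le> C\<close> in \<open>simp add: L2_norm_nonneg\<close>)

text \<open>
  Since Lebesgue measure is complete, \<open>g\<close> inherits measurability from \<open>f\<close>. The initial datum is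
  compared with \<open>B 0\<close> in this way.
\<close>

lemma L2_norm_cong_AE:
  fixes f g :: "real^2 \<Rightarrow> 'b::euclidean_space"
  assumes "open \<Omega>" and f: "f \<in> L2 \<Omega>" and ae: "AE x in lebesgue_on \<Omega>. f x = g x"
  shows "L2_norm \<Omega> f = L2_norm \<Omega> g"
proof -
  have \<Omega>: "\<Omega> \<inter> space lebesgue \<in> sets lebesgue" using \<open>open \<Omega>\<close> by simp
  have fm: "f \<in> borel_measurable (lebesgue_on \<Omega>)" using f by (simp add: L2_def)
  have "AE x in lebesgue. x \<in> \<Omega> \<longrightarrow> f x = g x"
    using ae unfolding AE_restrict_space_iff[OF \<Omega>] by simp
  then have "AE x in lebesgue. indicat_real \<Omega> x *\<^sub>R f x = indicat_real \<Omega> x *\<^sub>R g x"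
    by eventually_elim (auto simp: indicator_def)
  with fm have gm: "g \<in> borel_measurable (lebesgue_on \<Omega>)"
    unfolding borel_measurable_restrict_space_iff[OF \<Omega>] by (rule borel_measurable_AE)
  have "L2_inner \<Omega> f f = L2_inner \<Omega> g g"
    unfolding L2_inner_def
  proof (rule integral_cong_AE)
    show "AE x in lebesgue_on \<Omega>. f x \<bullet> f x = g x \<bullet> g x"
      using ae by eventually_elim simp
  qed (use fm gm in auto)
  then show ?thesis by (simp add: L2_norm_def)
qed

section \<open>Functions of time with values in $L^2$\<close>

lemma L2_tendsto_inner:
  assumes "\<forall>\<^sub>F s in F. f s \<in> L2 \<Omega>" "g \<in> L2 \<Omega>" "h \<in> L2 \<Omega>"
    and lim: "((\<lambda>s. L2_norm \<Omega> (\<lambda>x. f s x - g x)) \<longlongrightarrow> 0) F"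
  shows "((\<lambda>s. L2_inner \<Omega> (f s) h) \<longlongrightarrow> L2_inner \<Omega> g h) F"
proof -
  have "((\<lambda>s. L2_norm \<Omega> (\<lambda>x. f s x - g x) * L2_norm \<Omega> h) \<longlongrightarrow> 0) F"
    using lim by (auto intro: tendsto_eq_intros)
  then have "((\<lambda>s. L2_inner \<Omega> (f s) h - L2_inner \<Omega> g h) \<longlongrightarrow> 0) F"
  proof (rule Lim_null_comparison[rotated])
    show "\<forall>\<^sub>F s in F. norm (L2_inner \<Omega> (f s) h - L2_inner \<Omega> g h)
        \<le> L2_norm \<Omega> (\<lambda>x. f s x - g x) * L2_norm \<Omega> h"
      using assms(1)
    proof eventually_elim
      case (elim s)
      have "L2_inner \<Omega> (f s) h = L2_inner \<Omega> g h + L2_inner \<Omega> (\<lambda>x. f s x - g x) h"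
        using L2_inner_add_left[OF assms(2) L2_diff[OF elim assms(2)] assms(3)] by simp
      with L2_Cauchy_Schwarz[OF L2_diff[OF elim assms(2)] assms(3)] show ?case by simp
    qed
  qed
  then show ?thesis by (simp add: LIM_zero_iff)
qed

lemma L2_tendsto_norm_squared:
  assumes "\<forall>\<^sub>F s in F. f s \<in> L2 \<Omega>" "g \<in> L2 \<Omega>"
    and lim: "((\<lambda>s. L2_norm \<Omega> (\<lambda>x. f s x - g x)) \<longlongrightarrow> 0) F"
  shows "((\<lambda>s. (L2_norm \<Omega> (f s))\<^sup>2) \<longlongrightarrow> (L2_norm \<Omega> g)\<^sup>2) F"
proof -
  have "((\<lambda>s. (L2_norm \<Omega> (\<lambda>x. f s x - g x))\<^sup>2 + 2 * L2_inner \<Omega> (f s) g - L2_inner \<Omega> g g) \<longlongrightarrow>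
      0\<^sup>2 + 2 * L2_inner \<Omega> g g - L2_inner \<Omega> g g) F"
    by (intro tendsto_intros lim L2_tendsto_inner assms)
  moreover have "\<forall>\<^sub>F s in F. (L2_norm \<Omega> (\<lambda>x. f s x - g x))\<^sup>2 + 2 * L2_inner \<Omega> (f s) g - L2_inner \<Omega> g g
      = (L2_norm \<Omega> (f s))\<^sup>2"
    using assms(1)
  proof eventually_elim
    case (elim s)
    show ?case
      using L2_inner_add_self[OF L2_diff[OF elim assms(2)] assms(2)]
        L2_inner_add_left[OF L2_diff[OF elim assms(2)] assms(2) assms(2)]
      by (simp add: L2_norm_squared)
  qed
  ultimately have "((\<lambda>s. (L2_norm \<Omega> (f s))\<^sup>2) \<longlongrightarrow>
      0\<^sup>2 + 2 * L2_inner \<Omega> g g - L2_inner \<Omega> g g) F"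
    by (rule Lim_transform_eventually)
  then show ?thesis by (simp add: L2_norm_squared)
qed

text \<open>
  With the difference quotient \<open>q s\<close> one has \<open>f s = f t + (s - t) q s\<close>, so the difference quotient
  of the squared norm is \<open>2 (q s, f t) + (s - t) \<parallel>q s\<parallel>\<^sup>2\<close>.
\<close>

lemma L2_norm_squared_has_derivative:
  fixes f :: "real \<Rightarrow> real^2 \<Rightarrow> 'b::euclidean_space"
  assumes f: "\<And>s. s \<in> I \<Longrightarrow> f s \<in> L2 \<Omega>" and t: "t \<in> I" and f': "f' \<in> L2 \<Omega>"
    and lim: "((\<lambda>s. L2_norm \<Omega> (\<lambda>x. (f s x - f t x) /\<^sub>R (s - t) - f' x)) \<longlongrightarrow> 0) (at t within I)"
  shows "((\<lambda>s. (L2_norm \<Omega> (f s))\<^sup>2) has_real_derivative 2 * L2_inner \<Omega> f' (f t)) (at t within I)"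
proof -
  let ?q = "\<lambda>s x. (f s x - f t x) /\<^sub>R (s - t)"
  have ev: "\<forall>\<^sub>F s in at t within I. s \<in> I \<and> s \<noteq> t"
    by (simp add: eventually_at_filter)
  have q: "?q s \<in> L2 \<Omega>" if "s \<in> I" for s
    by (intro L2_scaleR L2_diff f t that)
  have evq: "\<forall>\<^sub>F s in at t within I. ?q s \<in> L2 \<Omega>"
    using ev by eventually_elim (use q in blast)
  have "((\<lambda>s. 2 * L2_inner \<Omega> (?q s) (f t) + (s - t) * (L2_norm \<Omega> (?q s))\<^sup>2) \<longlongrightarrow>
      2 * L2_inner \<Omega> f' (f t) + (t - t) * (L2_norm \<Omega> f')\<^sup>2) (at t within I)"
    by (intro tendsto_intros L2_tendsto_inner L2_tendsto_norm_squared evq f' f t lim)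
  moreover have "\<forall>\<^sub>F s in at t within I. 2 * L2_inner \<Omega> (?q s) (f t) + (s - t) * (L2_norm \<Omega> (?q s))\<^sup>2
      = ((L2_norm \<Omega> (f s))\<^sup>2 - (L2_norm \<Omega> (f t))\<^sup>2) / (s - t)"
    using ev
  proof eventually_elim
    case (elim s)
    have "f s = (\<lambda>x. f t x + (s - t) *\<^sub>R ?q s x)"
      using elim by simp
    from arg_cong[OF this, of "\<lambda>v. (L2_norm \<Omega> v)\<^sup>2"]
    have E: "(L2_norm \<Omega> (f s))\<^sup>2 = (L2_norm \<Omega> (f t))\<^sup>2
        + 2 * (s - t) * L2_inner \<Omega> (?q s) (f t) + (s - t)\<^sup>2 * (L2_norm \<Omega> (?q s))\<^sup>2"
      by (rule trans) (intro L2_norm_squared_add_scaleR f t q conjunct1[OF elim])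
    have "(L2_norm \<Omega> (f s))\<^sup>2 - (L2_norm \<Omega> (f t))\<^sup>2
        = (2 * L2_inner \<Omega> (?q s) (f t) + (s - t) * (L2_norm \<Omega> (?q s))\<^sup>2) * (s - t)"
      unfolding E by (simp only: power2_eq_square) (simp only: algebra_simps)
    then show ?case
      using elim by (simp only: eq_divide_eq) simp
  qed
  ultimately have "((\<lambda>s. ((L2_norm \<Omega> (f s))\<^sup>2 - (L2_norm \<Omega> (f t))\<^sup>2) / (s - t)) \<longlongrightarrow>
      2 * L2_inner \<Omega> f' (f t) + (t - t) * (L2_norm \<Omega> f')\<^sup>2) (at t within I)"
    by (rule Lim_transform_eventually)
  then show ?thesis by (simp add: has_field_derivative_iff)
qed

lemma L2_norm_le_Hdiv_norm: "L2_norm \<Omega> w \<le> Hdiv_norm \<Omega> w"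
  unfolding Hdiv_norm_def by (rule real_le_rsqrt) simp

lemma L2_norm_le_Hrot_norm: "L2_norm \<Omega> v \<le> Hrot_norm \<Omega> v"
  unfolding Hrot_norm_def by (rule real_le_rsqrt) simp

lemma L2_norm_tendsto_0:
  assumes "((\<lambda>s. N (f s)) \<longlongrightarrow> 0) F" "\<And>v. L2_norm \<Omega> v \<le> N v"
  shows "((\<lambda>s. L2_norm \<Omega> (f s)) \<longlongrightarrow> 0) F"
  by (rule Lim_null_comparison[OF _ assms(1)]) (simp add: L2_norm_nonneg assms(2))

lemma has_derivative_L2_norm_squared_C1_time:
  assumes "C1_time T (Hdiv \<Omega>) (Hdiv_norm \<Omega>) B B'" "t \<in> {0..T}"
  shows "((\<lambda>s. (L2_norm \<Omega> (B s))\<^sup>2) has_real_derivative 2 * L2_inner \<Omega> (B' t) (B t)) (at t within {0..T})"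
proof (rule L2_norm_squared_has_derivative)
  show "B s \<in> L2 \<Omega>" if "s \<in> {0..T}" for s
    using assms that by (auto simp: C1_time_def C0_time_def Hdiv_def)
  show "B' t \<in> L2 \<Omega>"
    using assms by (auto simp: C1_time_def C0_time_def Hdiv_def)
  have "((\<lambda>s. Hdiv_norm \<Omega> (\<lambda>x. (B s x - B t x) /\<^sub>R (s - t) - B' t x)) \<longlongrightarrow> 0) (at t within {0..T})"
    using assms by (auto simp: C1_time_def)
  then show "((\<lambda>s. L2_norm \<Omega> (\<lambda>x. (B s x - B t x) /\<^sub>R (s - t) - B' t x)) \<longlongrightarrow> 0) (at t within {0..T})"
    by (rule L2_norm_tendsto_0[where N="Hdiv_norm \<Omega>"]) (rule L2_norm_le_Hdiv_norm)
qed fact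

section \<open>Smooth bump functions on boxes\<close>

lemma partial_eqI: "(f has_derivative D) (at x) \<Longrightarrow> partial i f x = D (axis i 1)"
  unfolding partial_def by (metis frechet_derivative_at)

lemma partial_add:
  assumes "f differentiable (at x)" "g differentiable (at x)"
  shows "partial i (\<lambda>x. f x + g x) x = partial i f x + partial i g x"
  using partial_eqI[OF has_derivative_add[OF assms[THEN frechet_derivative_works[THEN iffD1]]]]
  by (simp add: partial_def)

lemma partial_mult:
  assumes "f differentiable (at x)" "g differentiable (at x)"
  shows "partial i (\<lambda>x. f x * g x) x = f x * partial i g x + partial i f x * g x"
  using partial_eqI[OF has_derivative_mult[OF assms[THEN frechet_derivative_works[THEN iffD1]]]]
  by (simp add: partial_def)

lemma Ck_const: "Ck k (\<lambda>x. c)"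
proof (induction k arbitrary: c)
  case (Suc k)
  have "partial i (\<lambda>x. c) = (\<lambda>x. 0)" for i
    by (rule ext) (simp add: partial_eqI[OF has_derivative_const])
  with Suc show ?case by simp
qed simp

lemma Ck_SucD: "Ck (Suc k) f \<Longrightarrow> Ck k f"
proof (induction k arbitrary: f)
  case 0
  then show ?case
    by (simp add: differentiable_imp_continuous_within continuous_at_imp_continuous_on)
qed auto

lemma Ck_add: "Ck k f \<Longrightarrow> Ck k g \<Longrightarrow> Ck k (\<lambda>x. f x + g x)"
proof (induction k arbitrary: f g)
  case (Suc k)
  then have "partial i (\<lambda>x. f x + g x) = (\<lambda>x. partial i f x + partial i g x)" for i
    by (auto simp: partial_add)
  with Suc show ?case by simp
qed (simp add: continuous_on_add)

text \<open>
  By the product rule a derivative of \<open>f g\<close> involves \<open>f\<close> and \<open>g\<close> themselves, which have to be known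
  to be of the lower class as well.
\<close>

lemma Ck_mult: "Ck k f \<Longrightarrow> Ck k g \<Longrightarrow> Ck k (\<lambda>x. f x * g x)"
proof (induction k arbitrary: f g)
  case (Suc k)
  then have "partial i (\<lambda>x. f x * g x) = (\<lambda>x. f x * partial i g x + partial i f x * g x)" for i
    by (auto simp: partial_mult)
  moreover have "Ck k f" "Ck k g"
    using Suc.prems by (blast intro: Ck_SucD)+
  ultimately show ?case using Suc by (auto intro!: Ck_add)
qed (simp add: continuous_on_mult)

text \<open>
  The smooth function that is flat at the origin, $\exp(-1/x)$ on the positive half line, is the
  case \<open>m = 0\<close>. The derivative of each member of the family is a linear combination of two others, so
  smoothness of all members follows by one induction.
\<close>

definition flat_exp :: "nat \<Rightarrow> real \<Rightarrow> real" where
  "flat_exp m x = (if 0 < x then exp (- (1 / x)) / x ^ m else 0)"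

text \<open>
  The exponential beats every power: substitute \<open>y = 1 / x\<close> and let \<open>y\<close> tend to infinity.
\<close>

lemma flat_exp_tendsto_0: "(flat_exp m \<longlongrightarrow> 0) (at 0)"
proof -
  have "((\<lambda>y::real. y ^ m / exp y) \<longlongrightarrow> 0) at_top"
    by (rule tendsto_power_div_exp_0)
  then have "((\<lambda>x::real. inverse x ^ m / exp (inverse x)) \<longlongrightarrow> 0) (at_right 0)"
    by (rule filterlim_compose[OF _ filterlim_inverse_at_top_right])
  then have "(flat_exp m \<longlongrightarrow> 0) (at_right 0)"
    by (rule tendsto_cong[THEN iffD1, rotated])
       (auto simp: eventually_at_filter flat_exp_def exp_minus field_simps)
  moreover have "(flat_exp m \<longlongrightarrow> 0) (at_left 0)"
    by (rule tendsto_eventually) (auto simp: eventually_at_filter flat_exp_def)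
  ultimately show ?thesis
    by (simp add: filterlim_at_split)
qed

text \<open>
  Away from the origin this is calculus. At the origin the difference quotient of one member is the
  value of the next one, which tends to \<open>0\<close>.
\<close>

lemma flat_exp_has_derivative:
  "(flat_exp m has_real_derivative flat_exp (m + 2) x - m * flat_exp (m + 1) x) (at x)"
proof -
  consider "x > 0" | "x < 0" | "x = 0" by linarith
  then show ?thesis
  proof cases
    case 1
    have "((\<lambda>x. exp (- (1 / x))) has_real_derivative exp (- (1 / x)) / x\<^sup>2) (at x)"
      using 1 by (auto intro!: derivative_eq_intros simp: power2_eq_square)
    from DERIV_divide[OF this DERIV_pow[of m]] 1
    have "((\<lambda>x. exp (- (1 / x)) / x ^ m) has_real_derivative
        (exp (- (1 / x)) / x\<^sup>2 * x ^ m - exp (- (1 / x)) * (m * x ^ (m - 1))) / (x ^ m * x ^ m)) (at x)"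
      by simp
    also have "m * x ^ (m - 1) = m * x ^ m / x"
      using 1 by (cases m) auto
    also have "(exp (- (1 / x)) / x\<^sup>2 * x ^ m - exp (- (1 / x)) * (m * x ^ m / x)) / (x ^ m * x ^ m)
        = flat_exp (m + 2) x - m * flat_exp (m + 1) x"
      using 1 by (simp add: flat_exp_def field_simps power2_eq_square)
    finally have "((\<lambda>x. exp (- (1 / x)) / x ^ m) has_real_derivative
        flat_exp (m + 2) x - m * flat_exp (m + 1) x) (at x)" .
    then show ?thesis
      by (rule has_field_derivative_transform_within_open[of _ _ _ "{0<..}"])
         (use 1 in \<open>auto simp: flat_exp_def\<close>)
  next
    case 2
    have "((\<lambda>x. 0) has_real_derivative flat_exp (m + 2) x - m * flat_exp (m + 1) x) (at x)"
      using 2 by (simp add: flat_exp_def)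
    then show ?thesis
      by (rule has_field_derivative_transform_within_open[of _ _ _ "{..<0}"])
         (use 2 in \<open>auto simp: flat_exp_def\<close>)
  next
    case 3
    \<comment> \<open>Also at negative increments, where both sides vanish.\<close>
    have "(\<lambda>h. (flat_exp m (0 + h) - flat_exp m 0) / h) = flat_exp (m + 1)"
      by (auto simp: flat_exp_def)
    with flat_exp_tendsto_0[of "m + 1"] 3 show ?thesis
      by (simp add: DERIV_def flat_exp_def)
  qed
qed

text \<open>
  The index \<open>m\<close> is generalised in the induction because each differentiation raises it.
\<close>

lemma Ck_flat_exp: "Ck k (\<lambda>x. flat_exp m (c * x $ i + d))"
proof (induction k arbitrary: m)
  case 0
  have "isCont (flat_exp m) y" for y
    using flat_exp_has_derivative DERIV_isCont by blast
  then have "continuous_on UNIV (flat_exp m)"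
    by (simp add: continuous_at_imp_continuous_on)
  then have "continuous_on UNIV (\<lambda>x::real^2. flat_exp m (c * x $ i + d))"
    by (rule continuous_on_compose2) (auto intro!: continuous_intros)
  then show ?case by simp
next
  case (Suc k)
  let ?g = "\<lambda>x::real^2. flat_exp (m + 2) (c * x $ i + d) - m * flat_exp (m + 1) (c * x $ i + d)"
  have D: "((\<lambda>x. flat_exp m (c * x $ i + d)) has_derivative (\<lambda>h. ?g x * (c * h $ i))) (at x)" for x
  proof -
    have "((\<lambda>x::real^2. c * x $ i + d) has_derivative (\<lambda>h. c * h $ i)) (at x)"
      by (auto intro!: derivative_eq_intros bounded_linear.has_derivative[OF bounded_linear_vec_nth])
    from has_derivative_compose[OF this flat_exp_has_derivative[unfolded has_field_derivative_def]]
    show ?thesis by simp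
  qed
  have "partial j (\<lambda>x. flat_exp m (c * x $ i + d)) = (\<lambda>x. (c * axis j 1 $ i) *
      (flat_exp (m + 2) (c * x $ i + d) + (- real m) * flat_exp (m + 1) (c * x $ i + d)))" for j
    by (rule ext, subst partial_eqI[OF D]) (simp add: algebra_simps)
  moreover have "(\<lambda>x. flat_exp m (c * x $ i + d)) differentiable (at x)" for x
    using D by (rule differentiableI)
  moreover have "Ck k (\<lambda>x. (c * axis j 1 $ i) *
      (flat_exp (m + 2) (c * x $ i + d) + (- real m) * flat_exp (m + 1) (c * x $ i + d)))" for j
    by (rule Ck_mult[OF Ck_const Ck_add[OF Suc Ck_mult[OF Ck_const Suc]]])
  ultimately show ?case
    by (simp only: Ck.simps) blast
qed

text \<open>
  A smooth stand-in for the indicator of the open box: each factor vanishes unless \<open>x\<close> lies on the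
  inner side of one edge, and the scaling by \<open>n\<close> pushes it up to \<open>1\<close> there.
\<close>

definition bump :: "real^2 \<Rightarrow> real^2 \<Rightarrow> nat \<Rightarrow> scalar_field" where
  "bump a b n x =
     (flat_exp 0 (real n * (x $ 1 - a $ 1)) * flat_exp 0 (real n * (b $ 1 - x $ 1))) *
     (flat_exp 0 (real n * (x $ 2 - a $ 2)) * flat_exp 0 (real n * (b $ 2 - x $ 2)))"

lemma flat_exp_le_1: "\<bar>flat_exp 0 x\<bar> \<le> 1"
  by (auto simp: flat_exp_def)

lemma bump_le_1: "\<bar>bump a b n x\<bar> \<le> 1"
  unfolding bump_def abs_mult by (intro mult_le_one flat_exp_le_1 mult_nonneg_nonneg abs_ge_zero)

lemma bump_outside:
  assumes "x \<notin> box a b" shows "bump a b n x = 0"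
proof -
  have "\<exists>i\<in>{1, 2}. x $ i \<le> a $ i \<or> b $ i \<le> x $ i"
    using assms by (auto simp: mem_box_cart forall_2 not_less)
  then have "\<exists>i\<in>{1, 2}. real n * (x $ i - a $ i) \<le> 0 \<or> real n * (b $ i - x $ i) \<le> 0"
    by (auto simp: mult_nonneg_nonpos)
  then show ?thesis
    unfolding bump_def flat_exp_def by auto
qed

lemma Ck_bump: "Ck k (bump a b n)"
proof -
  have affine: "real n * (y - a $ i) = real n * y + - (real n * a $ i)"
    "real n * (b $ i - y) = - real n * y + real n * b $ i" for y i
    by (simp_all add: algebra_simps)
  show ?thesis
    unfolding bump_def[abs_def] affine
    by (rule Ck_mult[OF Ck_mult[OF Ck_flat_exp Ck_flat_exp] Ck_mult[OF Ck_flat_exp Ck_flat_exp]])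
qed

lemma bump_test_function:
  assumes "cbox a b \<subseteq> \<Omega>" shows "bump a b n \<in> test_functions \<Omega>"
proof -
  have "closure {x. bump a b n x \<noteq> 0} \<subseteq> cbox a b"
    using bump_outside box_subset_cbox by (intro closure_minimal) (auto, blast)
  moreover from this have "compact (closure {x. bump a b n x \<noteq> 0})"
    by (meson bounded_cbox bounded_subset closed_closure compact_eq_bounded_closed)
  ultimately show ?thesis
    using assms by (auto simp: test_functions_def Ck_bump)
qed

lemma flat_exp_scaled_tendsto:
  assumes "0 < y" shows "(\<lambda>n. flat_exp 0 (real n * y)) \<longlonglongrightarrow> 1"
proof -
  have "(\<lambda>n. exp (- (inverse (real n) * inverse y))) \<longlonglongrightarrow> exp (- (0 * inverse y))"
    by (intro tendsto_intros lim_inverse_n)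
  moreover have "\<forall>\<^sub>F n in sequentially. exp (- (inverse (real n) * inverse y)) = flat_exp 0 (real n * y)"
    using eventually_gt_at_top[of 0]
    by eventually_elim (use assms in \<open>simp add: flat_exp_def divide_inverse\<close>)
  ultimately show ?thesis
    using tendsto_cong by fastforce
qed

lemma bump_tendsto_indicator: "(\<lambda>n. bump a b n x) \<longlonglongrightarrow> indicator (box a b) x"
proof (cases "x \<in> box a b")
  case True
  then have "0 < x $ i - a $ i" "0 < b $ i - x $ i" for i
    by (auto simp: mem_box_cart)
  then have "(\<lambda>n. (flat_exp 0 (n * (x $ 1 - a $ 1)) * flat_exp 0 (n * (b $ 1 - x $ 1))) *
     (flat_exp 0 (n * (x $ 2 - a $ 2)) * flat_exp 0 (n * (b $ 2 - x $ 2)))) \<longlonglongrightarrow> 1 * 1 * (1 * 1)"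
    by (intro tendsto_mult flat_exp_scaled_tendsto)
  with True show ?thesis
    by (simp add: bump_def algebra_simps)
qed (simp add: bump_outside)

section \<open>The fundamental lemma of the calculus of variations\<close>

lemma sigma_finite_lebesgue: "sigma_finite_measure (lebesgue :: 'a::euclidean_space measure)"
proof
  obtain A :: "'a set set" where A: "countable A" "A \<subseteq> sets lborel" "\<Union>A = space lborel"
      "\<forall>a\<in>A. emeasure lborel a \<noteq> \<infinity>"
    using lborel.sigma_finite_countable by blast
  then have "A \<subseteq> sets lebesgue" "\<forall>a\<in>A. emeasure lebesgue a \<noteq> \<infinity>"
    by (auto simp: subset_eq)
  with A show "\<exists>A. countable A \<and> A \<subseteq> sets (lebesgue :: 'a measure) \<and> \<Union>A = space lebesgue
      \<and> (\<forall>a\<in>A. emeasure lebesgue a \<noteq> \<infinity>)"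
    by (intro exI[of _ A]) simp
qed

text \<open>
  Boxes form an intersection-stable generator of the Borel sets, and the sets over which the part of
  \<open>h\<close> in the fixed box integrates to \<open>0\<close> form a Dynkin system. Cutting \<open>h\<close> off to one fixed box makes the
  Dynkin system contain the whole plane; a Lebesgue set differs from a Borel set by a null set.
\<close>

lemma AE_zero_if_box_integrals_zero:
  fixes h :: "real^2 \<Rightarrow> 'b::euclidean_space"
  assumes h: "integrable lebesgue h"
    and box0: "\<And>a b. cbox a b \<subseteq> cbox p q \<Longrightarrow> (LINT x|lebesgue. indicat_real (box a b) x *\<^sub>R h x) = 0"
  shows "AE x in lebesgue. x \<in> box p q \<longrightarrow> h x = 0"
proof -
  let ?Q = "box p q"
  let ?h = "\<lambda>x. indicat_real ?Q x *\<^sub>R h x"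
  have Q: "?Q \<in> sets lebesgue" by simp
  have hQ: "integrable lebesgue ?h"
    by (rule integrable_mult_indicator[OF Q h])
  have boxes: "set_lebesgue_integral lebesgue (box a b) ?h = 0" for a b
  proof (cases "box a b \<inter> ?Q = {}")
    case True
    then have "(\<lambda>x. indicat_real (box a b) x *\<^sub>R ?h x) = (\<lambda>x. 0)"
      by (intro ext) (auto simp: indicator_def)
    then show ?thesis by (simp only: set_lebesgue_integral_def integral_zero)
  next
    case False
    obtain c d where cd: "box a b \<inter> ?Q = box c d"
      using box_Int_box[of a b p q] by blast
    with False have "cbox c d = closure (box c d)"
      by (metis closure_box)
    also have "\<dots> \<subseteq> cbox p q"
      using closure_minimal[of "box c d" "cbox p q"] cd box_subset_cbox[of p q] closed_cbox by blast
    finally have "(LINT x|lebesgue. indicat_real (box c d) x *\<^sub>R h x) = 0"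
      by (rule box0)
    moreover have "indicat_real (box c d) x *\<^sub>R h x = indicat_real (box a b) x *\<^sub>R ?h x" for x
      unfolding cd[symmetric] indicator_inter_arith by (rule scaleR_scaleR[symmetric])
    ultimately show ?thesis
      by (simp only: set_lebesgue_integral_def)
  qed
  have borel: "set_lebesgue_integral lebesgue A ?h = 0" if "A \<in> sets borel" for A
  proof -
    let ?G = "range (\<lambda>(a, b). box a b) :: (real^2) set set"
    have G: "sigma_sets UNIV ?G = sets borel"
      unfolding borel_eq_box by simp
    have "Int_stable ?G"
      by (auto simp: Int_stable_def box_Int_box)
    moreover have "?G \<subseteq> Pow UNIV" by simp
    moreover have "A \<in> sigma_sets UNIV ?G"
      using that unfolding G .
    ultimately show ?thesis
    proof (induction rule: sigma_sets_induct_disjoint)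
      case (basic A) then show ?case using boxes by auto
    next
      case empty then show ?case by (simp add: set_lebesgue_integral_def)
    next
      case (compl A)
      then have A: "A \<in> sets lebesgue" unfolding G by simp
      have "indicat_real (UNIV - A) x *\<^sub>R ?h x = ?h x - indicat_real A x *\<^sub>R ?h x" for x
        by (simp add: indicator_def)
      then have "set_lebesgue_integral lebesgue (UNIV - A) ?h
          = (LINT x|lebesgue. ?h x) - set_lebesgue_integral lebesgue A ?h"
        unfolding set_lebesgue_integral_def
        by (simp only:) (intro Bochner_Integration.integral_diff hQ integrable_mult_indicator A)
      also have "(LINT x|lebesgue. ?h x) = 0"
        by (intro box0) simp
      finally show ?case using compl by simp
    next
      case (union A)
      then have A: "A i \<in> sets lebesgue" for i unfolding G by auto
      have "set_integrable lebesgue (\<Union>i. A i) ?h"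
        unfolding set_integrable_def using A by (intro integrable_mult_indicator hQ) auto
      then have "set_lebesgue_integral lebesgue (\<Union>i. A i) ?h
          = (\<Sum>i. set_lebesgue_integral lebesgue (A i) ?h)"
        using union(1) A by (intro lebesgue_integral_countable_add) (auto simp: disjoint_family_on_def)
      then show ?case using union by simp
    qed
  qed
  have "AE x in lebesgue. ?h x = 0"
  proof (rule sigma_finite_measure.density_zero[OF sigma_finite_lebesgue hQ])
    fix A :: "(real^2) set" assume "A \<in> sets lebesgue"
    then obtain S N N' where A: "A = S \<union> N" "N \<subseteq> N'" "N' \<in> null_sets lborel" "S \<in> sets lborel"
      by (rule sets_completionE)
    have "AE x in lebesgue. x \<notin> N'"
      using A(3) by (intro AE_completion AE_not_in)
    then have "AE x in lebesgue. indicat_real A x *\<^sub>R ?h x = indicat_real S x *\<^sub>R ?h x"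
      by eventually_elim (use A in \<open>auto simp: indicator_def\<close>)
    moreover have "(\<lambda>x. indicat_real X x *\<^sub>R ?h x) \<in> borel_measurable lebesgue" if "X \<in> sets lebesgue" for X
      by (rule borel_measurable_scaleR[OF borel_measurable_indicator[OF that] borel_measurable_integrable[OF hQ]])
    ultimately have "set_lebesgue_integral lebesgue A ?h = set_lebesgue_integral lebesgue S ?h"
      unfolding set_lebesgue_integral_def
      by (intro integral_cong_AE) (use \<open>A \<in> sets lebesgue\<close> A(4) in auto)
    with A(4) show "set_lebesgue_integral lebesgue A ?h = 0"
      using borel by simp
  qed
  then show ?thesis
    by eventually_elim (simp add: indicator_def split: if_splits)
qed

text \<open>
  By dominated convergence the bump functions may be replaced by indicators of boxes whose closure
  lies in \<open>\<Omega>\<close>, so \<open>r\<close> vanishes almost everywhere in each such box. Countably many of them cover \<open>\<Omega>\<close> up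
  to their null boundaries.
\<close>

lemma fundamental_lemma_calculus_of_variations:
  fixes r :: "real^2 \<Rightarrow> 'b::euclidean_space"
  assumes "open \<Omega>" and r: "integrable (lebesgue_on \<Omega>) r"
    and zero: "\<And>\<phi>. \<phi> \<in> test_functions \<Omega> \<Longrightarrow> (LINT x|lebesgue_on \<Omega>. \<phi> x *\<^sub>R r x) = 0"
  shows "AE x in lebesgue_on \<Omega>. r x = 0"
proof -
  let ?h = "\<lambda>x. indicat_real \<Omega> x *\<^sub>R r x"
  have \<Omega>: "\<Omega> \<in> sets lebesgue" using \<open>open \<Omega>\<close> by simp
  have h: "integrable lebesgue ?h"
    using r \<Omega> by (simp add: integrable_restrict_space)
  have box0: "(LINT x|lebesgue. indicat_real (box a b) x *\<^sub>R ?h x) = 0" if ab: "cbox a b \<subseteq> \<Omega>" for a b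
  proof (rule LIMSEQ_unique)
    have meas: "bump a b n \<in> borel_measurable lebesgue" for n
      using Ck_bump[of 0 a b n] by (intro measurable_completion) (simp add: borel_measurable_continuous_onI)
    show "(\<lambda>n. LINT x|lebesgue. bump a b n x *\<^sub>R ?h x) \<longlonglongrightarrow>
        (LINT x|lebesgue. indicat_real (box a b) x *\<^sub>R ?h x)"
    proof (rule integral_dominated_convergence)
      show "integrable lebesgue (\<lambda>x. norm (?h x))" using h by (rule integrable_norm)
      show "(\<lambda>x. indicat_real (box a b) x *\<^sub>R ?h x) \<in> borel_measurable lebesgue"
        by (rule borel_measurable_scaleR[OF borel_measurable_indicator borel_measurable_integrable[OF h]]) simp
      show "(\<lambda>x. bump a b n x *\<^sub>R ?h x) \<in> borel_measurable lebesgue" for n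
        by (rule borel_measurable_scaleR[OF meas borel_measurable_integrable[OF h]])
      show "AE x in lebesgue. (\<lambda>n. bump a b n x *\<^sub>R ?h x) \<longlonglongrightarrow> indicat_real (box a b) x *\<^sub>R ?h x"
        by (intro AE_I2 tendsto_intros bump_tendsto_indicator)
      show "AE x in lebesgue. norm (bump a b n x *\<^sub>R ?h x) \<le> norm (?h x)" for n
        using bump_le_1[of a b n] by (intro AE_I2) (simp add: mult_left_le_one_le del: scaleR_scaleR)
    qed
    have "(LINT x|lebesgue. bump a b n x *\<^sub>R ?h x) = (LINT x|lebesgue_on \<Omega>. bump a b n x *\<^sub>R r x)" for n
      using \<Omega> by (simp add: integral_restrict_space mult.commute)
    then show "(\<lambda>n. LINT x|lebesgue. bump a b n x *\<^sub>R ?h x) \<longlonglongrightarrow> 0"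
      using zero[OF bump_test_function[OF ab]] by simp
  qed
  obtain \<D> where \<D>: "countable \<D>" "\<D> \<subseteq> Pow \<Omega>" "\<And>X. X \<in> \<D> \<Longrightarrow> \<exists>a b. X = cbox a b" "\<Union>\<D> = \<Omega>"
    using open_countable_Union_open_cbox[OF \<open>open \<Omega>\<close>] by metis
  have "AE x in lebesgue. x \<in> X \<longrightarrow> ?h x = 0" if X: "X \<in> \<D>" for X
  proof -
    obtain p q where pq: "X = cbox p q" using \<D>(3)[OF X] by blast
    have "AE x in lebesgue. x \<in> box p q \<longrightarrow> ?h x = 0"
      by (rule AE_zero_if_box_integrals_zero[OF h box0]) (use pq \<D>(2) X in auto)
    \<comment> \<open>The cover consists of closed boxes, the preceding step handles their interiors.\<close>
    moreover have "AE x in lebesgue. x \<notin> cbox p q - box p q"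
      using negligible_frontier_interval negligible_iff_null_sets AE_not_in by blast
    ultimately show ?thesis
      unfolding pq by eventually_elim auto
  qed
  then have "AE x in lebesgue. \<forall>X\<in>\<D>. x \<in> X \<longrightarrow> ?h x = 0"
    unfolding AE_ball_countable[OF \<D>(1)] by blast
  then have "AE x in lebesgue. x \<in> \<Omega> \<longrightarrow> r x = 0"
    by eventually_elim (use \<D>(4) in \<open>auto simp: indicator_def\<close>)
  then show ?thesis
    using \<Omega> by (simp add: AE_restrict_space_iff)
qed

section \<open>Additivity of the weak rotation\<close>

lemma test_function_L2:
  assumes "open \<Omega>" "bounded \<Omega>" "\<phi> \<in> test_functions \<Omega>" shows "\<phi> \<in> L2 \<Omega>"
proof -
  have "Ck 0 \<phi>" using assms(3) by (auto simp only: test_functions_def mem_Collect_eq)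
  with assms show ?thesis by (intro L2_bounded_continuous) auto
qed

lemma classical_rot_test_function_L2:
  assumes "open \<Omega>" "bounded \<Omega>" "\<phi> \<in> test_functions \<Omega>" shows "classical_rot \<phi> \<in> L2 \<Omega>"
proof (rule L2_bounded_continuous)
  have "Ck (Suc 0) \<phi>" using assms(3) by (auto simp only: test_functions_def mem_Collect_eq)
  then have "continuous_on UNIV (\<lambda>x. partial 2 \<phi> x *\<^sub>R (axis 1 1 :: real^2) - partial 1 \<phi> x *\<^sub>R axis 2 1)"
    by (auto intro!: continuous_intros)
  also have "(\<lambda>x. partial 2 \<phi> x *\<^sub>R (axis 1 1 :: real^2) - partial 1 \<phi> x *\<^sub>R axis 2 1) = classical_rot \<phi>"
    by (rule ext) (simp add: classical_rot_def vec_eq_iff forall_2 axis_def)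
  finally show "continuous_on UNIV (classical_rot \<phi>)" .
qed fact+

text \<open>
  Justifies treating the representative chosen by \<^const>\<open>weak_rot\<close> as the rotation.
\<close>

lemma is_weak_rot_unique:
  assumes "open \<Omega>" "bounded \<Omega>" "is_weak_rot \<Omega> v r" "is_weak_rot \<Omega> v r'"
  shows "AE x in lebesgue_on \<Omega>. r x = r' x"
proof -
  have L2: "r \<in> L2 \<Omega>" "r' \<in> L2 \<Omega>"
    using assms by (auto simp: is_weak_rot_def)
  have "AE x in lebesgue_on \<Omega>. r x - r' x = 0"
  proof (rule fundamental_lemma_calculus_of_variations)
    show "integrable (lebesgue_on \<Omega>) (\<lambda>x. r x - r' x)"
      using assms L2 by (intro Bochner_Integration.integrable_diff L2_imp_integrable)
    fix \<phi> assume \<phi>: "\<phi> \<in> test_functions \<Omega>"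
    then have "(LINT x|lebesgue_on \<Omega>. v x *\<^sub>R classical_rot \<phi> x) = - (LINT x|lebesgue_on \<Omega>. \<phi> x *\<^sub>R r x)"
      "(LINT x|lebesgue_on \<Omega>. v x *\<^sub>R classical_rot \<phi> x) = - (LINT x|lebesgue_on \<Omega>. \<phi> x *\<^sub>R r' x)"
      using assms(3,4) by (auto simp: is_weak_rot_def)
    from trans[OF sym[OF this(1)] this(2)]
    have "(LINT x|lebesgue_on \<Omega>. \<phi> x *\<^sub>R r x) = (LINT x|lebesgue_on \<Omega>. \<phi> x *\<^sub>R r' x)"
      by (simp only: neg_equal_iff_equal)
    moreover have "(LINT x|lebesgue_on \<Omega>. \<phi> x *\<^sub>R (r x - r' x))
        = (LINT x|lebesgue_on \<Omega>. \<phi> x *\<^sub>R r x) - (LINT x|lebesgue_on \<Omega>. \<phi> x *\<^sub>R r' x)"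
      unfolding scaleR_diff_right
      by (intro Bochner_Integration.integral_diff integrable_L2_scaleR test_function_L2 assms(1,2) \<phi> L2)
    ultimately show "(LINT x|lebesgue_on \<Omega>. \<phi> x *\<^sub>R (r x - r' x)) = 0"
      by (simp only: diff_self)
  qed fact
  then show ?thesis by simp
qed

lemma is_weak_rot_add:
  assumes "open \<Omega>" "bounded \<Omega>" "v \<in> L2 \<Omega>" "w \<in> L2 \<Omega>" "is_weak_rot \<Omega> v r" "is_weak_rot \<Omega> w q"
  shows "is_weak_rot \<Omega> (\<lambda>x. v x + w x) (\<lambda>x. r x + q x)"
  unfolding is_weak_rot_def
proof (intro conjI ballI)
  have L2: "r \<in> L2 \<Omega>" "q \<in> L2 \<Omega>"
    using assms by (auto simp: is_weak_rot_def)
  then show "(\<lambda>x. r x + q x) \<in> L2 \<Omega>" by (rule L2_add)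
  fix \<phi> assume \<phi>: "\<phi> \<in> test_functions \<Omega>"
  have "(LINT x|lebesgue_on \<Omega>. v x *\<^sub>R classical_rot \<phi> x) = - (LINT x|lebesgue_on \<Omega>. \<phi> x *\<^sub>R r x)"
    "(LINT x|lebesgue_on \<Omega>. w x *\<^sub>R classical_rot \<phi> x) = - (LINT x|lebesgue_on \<Omega>. \<phi> x *\<^sub>R q x)"
    using assms(5,6) \<phi> by (auto simp: is_weak_rot_def)
  moreover have "(LINT x|lebesgue_on \<Omega>. (v x + w x) *\<^sub>R classical_rot \<phi> x)
      = (LINT x|lebesgue_on \<Omega>. v x *\<^sub>R classical_rot \<phi> x) + (LINT x|lebesgue_on \<Omega>. w x *\<^sub>R classical_rot \<phi> x)"
    unfolding scaleR_add_left
    by (intro Bochner_Integration.integral_add integrable_L2_scaleR classical_rot_test_function_L2 assms(1-4) \<phi>)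
  moreover have "(LINT x|lebesgue_on \<Omega>. \<phi> x *\<^sub>R (r x + q x))
      = (LINT x|lebesgue_on \<Omega>. \<phi> x *\<^sub>R r x) + (LINT x|lebesgue_on \<Omega>. \<phi> x *\<^sub>R q x)"
    unfolding scaleR_add_right
    by (intro Bochner_Integration.integral_add integrable_L2_scaleR test_function_L2 assms(1,2) \<phi> L2)
  ultimately show "(LINT x|lebesgue_on \<Omega>. (v x + w x) *\<^sub>R classical_rot \<phi> x)
      = - (LINT x|lebesgue_on \<Omega>. \<phi> x *\<^sub>R (r x + q x))"
    by (simp only: minus_add_distrib)
qed

lemma is_weak_rot_weak_rot: "v \<in> Hrot \<Omega> \<Longrightarrow> is_weak_rot \<Omega> v (weak_rot \<Omega> v)"
  unfolding weak_rot_def Hrot_def mem_Collect_eq by (elim conjE) (rule someI_ex[of "is_weak_rot \<Omega> v"])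

lemma weak_rot_L2: "v \<in> Hrot \<Omega> \<Longrightarrow> weak_rot \<Omega> v \<in> L2 \<Omega>"
  using is_weak_rot_weak_rot by (auto simp: is_weak_rot_def)

text \<open>
  Faraday's law contains the rotation of a sum, whereas the energy argument needs the two rotations
  separately; a choice of representatives is additive only up to null sets.
\<close>

lemma weak_rot_add:
  assumes "open \<Omega>" "bounded \<Omega>" "v \<in> Hrot \<Omega>" "w \<in> Hrot \<Omega>"
  shows "(\<lambda>x. v x + w x) \<in> Hrot \<Omega>"
    and "AE x in lebesgue_on \<Omega>. weak_rot \<Omega> (\<lambda>x. v x + w x) x = weak_rot \<Omega> v x + weak_rot \<Omega> w x"
proof -
  have L2: "v \<in> L2 \<Omega>" "w \<in> L2 \<Omega>" using assms by (auto simp: Hrot_def)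
  have sum: "is_weak_rot \<Omega> (\<lambda>x. v x + w x) (\<lambda>x. weak_rot \<Omega> v x + weak_rot \<Omega> w x)"
    by (intro is_weak_rot_add L2 is_weak_rot_weak_rot assms)
  with L2_add[OF L2] show "(\<lambda>x. v x + w x) \<in> Hrot \<Omega>"
    by (auto simp: Hrot_def)
  then show "AE x in lebesgue_on \<Omega>. weak_rot \<Omega> (\<lambda>x. v x + w x) x = weak_rot \<Omega> v x + weak_rot \<Omega> w x"
    by (intro is_weak_rot_unique[OF assms(1,2) _ sum] is_weak_rot_weak_rot)
qed

section \<open>The energy inequality\<close>

text \<open>
  The real-valued norm is the essential supremum only if the latter is finite; essential boundedness
  rules out \<open>\<infinity>\<close>, and \<open>-\<infinity>\<close> occurs only when every property holds almost everywhere.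
\<close>

lemma Linf_norm_AE:
  assumes "u \<in> Linf \<Omega>"
  shows "AE x in lebesgue_on \<Omega>. norm (u x) \<le> Linf_norm \<Omega> u"
proof -
  let ?e = "esssup (lebesgue_on \<Omega>) (\<lambda>x. ereal (norm (u x)))"
  obtain C where "u \<in> borel_measurable (lebesgue_on \<Omega>)" and C: "AE x in lebesgue_on \<Omega>. norm (u x) \<le> C"
    using assms by (auto simp: Linf_def)
  then have "(\<lambda>x. ereal (norm (u x))) \<in> borel_measurable (lebesgue_on \<Omega>)"
    by measurable
  then have e: "?e \<le> ereal C"
    using C by (intro esssup_I) auto
  have "AE x in lebesgue_on \<Omega>. ereal (norm (u x)) \<le> ?e"
    by (rule esssup_AE)
  then show ?thesis
  proof eventually_elim
    case (elim x)
    with e show ?case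
      unfolding Linf_norm_def by (cases ?e) auto
  qed
qed

text \<open>
  Lagrange's identity: the squares of the cross and the inner product add up to the product of the
  squared norms.
\<close>

lemma abs_cross2_le: "\<bar>cross2 a b\<bar> \<le> norm a * norm b"
proof (rule power2_le_imp_le)
  have norm2: "(norm v)\<^sup>2 = (v $ 1)\<^sup>2 + (v $ 2)\<^sup>2" for v :: "real^2"
    by (simp only: power2_norm_eq_inner) (simp add: inner_vec_def sum_2 power2_eq_square)
  have "(norm a * norm b)\<^sup>2 - (cross2 a b)\<^sup>2 = (a $ 1 * b $ 1 + a $ 2 * b $ 2)\<^sup>2"
    unfolding power_mult_distrib norm2 cross2_def by (simp add: power2_eq_square algebra_simps)
  then show "\<bar>cross2 a b\<bar>\<^sup>2 \<le> (norm a * norm b)\<^sup>2"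
    by (metis diff_ge_0_iff_ge power2_abs zero_le_power2)
qed simp

text \<open>
  Multiplication by the square root of the weight is bounded, so \<open>\<parallel>\<sigma>\<^sup>1\<^sup>/\<^sup>2 v\<parallel>\<close> depends continuously on
  \<open>v\<close>.
\<close>

lemma L2_sqrt_mult:
  assumes "\<sigma> \<in> borel_measurable (lebesgue_on \<Omega>)" "AE x in lebesgue_on \<Omega>. 0 \<le> \<sigma> x \<and> \<sigma> x \<le> s"
    and v: "v \<in> L2 \<Omega>" and "0 \<le> s"
  shows "(\<lambda>x. sqrt (\<sigma> x) * v x) \<in> L2 \<Omega>"
    and "L2_norm \<Omega> (\<lambda>x. sqrt (\<sigma> x) * v x) \<le> sqrt s * L2_norm \<Omega> v"
proof -
  have le: "AE x in lebesgue_on \<Omega>. \<bar>sqrt (\<sigma> x)\<bar> \<le> sqrt s"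
    using assms(2) by eventually_elim simp
  moreover have "(\<lambda>x. sqrt (\<sigma> x)) \<in> borel_measurable (lebesgue_on \<Omega>)"
    using assms(1) by measurable
  ultimately show L2: "(\<lambda>x. sqrt (\<sigma> x) * v x) \<in> L2 \<Omega>"
    using L2_mult_essentially_bounded[OF _ _ v, of "\<lambda>x. sqrt (\<sigma> x)" "sqrt s"] by simp
  have "AE x in lebesgue_on \<Omega>. norm (sqrt (\<sigma> x) * v x) \<le> sqrt s * norm (v x)"
    using le by eventually_elim (simp add: abs_mult mult_right_mono)
  then show "L2_norm \<Omega> (\<lambda>x. sqrt (\<sigma> x) * v x) \<le> sqrt s * L2_norm \<Omega> v"
    by (intro L2_norm_dominated L2 v) (simp add: \<open>0 \<le> s\<close>)
qed

lemma L2_inner_split_weight: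
  assumes "\<sigma> \<in> borel_measurable (lebesgue_on \<Omega>)" "AE x in lebesgue_on \<Omega>. 0 \<le> \<sigma> x \<and> \<sigma> x \<le> s"
    and "v \<in> L2 \<Omega>" "w \<in> L2 \<Omega>"
  shows "L2_inner \<Omega> (\<lambda>x. \<sigma> x * v x) w = L2_inner \<Omega> (\<lambda>x. sqrt (\<sigma> x) * v x) (\<lambda>x. sqrt (\<sigma> x) * w x)"
  unfolding L2_inner_def
proof (rule integral_cong_AE)
  have [measurable]: "v \<in> borel_measurable (lebesgue_on \<Omega>)" "w \<in> borel_measurable (lebesgue_on \<Omega>)"
    using assms by (auto simp: L2_def)
  note [measurable] = assms(1)
  show "(\<lambda>x. (\<sigma> x * v x) \<bullet> w x) \<in> borel_measurable (lebesgue_on \<Omega>)"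
    "(\<lambda>x. (sqrt (\<sigma> x) * v x) \<bullet> (sqrt (\<sigma> x) * w x)) \<in> borel_measurable (lebesgue_on \<Omega>)"
    by measurable
  show "AE x in lebesgue_on \<Omega>. (\<sigma> x * v x) \<bullet> w x = (sqrt (\<sigma> x) * v x) \<bullet> (sqrt (\<sigma> x) * w x)"
    using assms(2)
  proof eventually_elim
    case (elim x)
    have "(sqrt (\<sigma> x) * v x) \<bullet> (sqrt (\<sigma> x) * w x) = (sqrt (\<sigma> x) * sqrt (\<sigma> x)) * (v x * w x)"
      by (simp only: inner_real_def ac_simps)
    also have "sqrt (\<sigma> x) * sqrt (\<sigma> x) = \<sigma> x"
      using elim by simp
    finally show ?case by (simp only: inner_real_def ac_simps)
  qed
qed

text \<open>
  Testing Faraday's law with \<open>B\<close> and Ohm's law with \<open>e\<close> and cancelling the coupling term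
  \<open>(rot e, B)\<close> leaves
  \<open>2 (B', B) + 2 \<parallel>\<sigma>\<^sup>1\<^sup>/\<^sup>2 e\<parallel>\<^sup>2 = - 2 (\<sigma> u \<times> B, e) - 2 (\<sigma> e0, e) - 2 (rot e0, B)\<close>.
  The terms on the right are absorbed by Young's inequality: the first costs half of
  \<open>\<parallel>\<sigma>\<^sup>1\<^sup>/\<^sup>2 e\<parallel>\<^sup>2\<close>, the second all of it once, so that one half survives on the left.
\<close>

lemma energy_inequality:
  fixes \<Omega> :: "(real^2) set" and u B B' :: vector_field and e e0 \<sigma> :: scalar_field
  assumes \<Omega>: "open \<Omega>" "bounded \<Omega>" and u: "u \<in> Linf \<Omega>"
    and \<sigma>: "\<sigma> \<in> borel_measurable (lebesgue_on \<Omega>)" "AE x in lebesgue_on \<Omega>. 0 \<le> \<sigma> x \<and> \<sigma> x \<le> s" and "0 \<le> s"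
    and B: "B \<in> L2 \<Omega>" and e: "e \<in> Hrot \<Omega>" and e0: "e0 \<in> Hrot \<Omega>"
    and faraday: "L2_inner \<Omega> B' B + L2_inner \<Omega> (weak_rot \<Omega> (\<lambda>x. e x + e0 x)) B = 0"
    and ohm: "L2_inner \<Omega> (\<lambda>x. \<sigma> x * e x) e + L2_inner \<Omega> (\<lambda>x. \<sigma> x * cross2 (u x) (B x)) e
        - L2_inner \<Omega> B (weak_rot \<Omega> e) = - L2_inner \<Omega> (\<lambda>x. \<sigma> x * e0 x) e"
  shows "2 * L2_inner \<Omega> B' B + 1/2 * (L2_norm \<Omega> (\<lambda>x. sqrt (\<sigma> x) * e x))\<^sup>2
    \<le> (Hrot_weighted_norm \<sigma> \<Omega> e0)\<^sup>2 + (2 * s * (Linf_norm \<Omega> u)\<^sup>2 + 1) * (L2_norm \<Omega> B)\<^sup>2"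
proof -
  let ?U = "Linf_norm \<Omega> u" and ?r = "weak_rot \<Omega> e" and ?q = "weak_rot \<Omega> e0"
  let ?c = "\<lambda>x. cross2 (u x) (B x)" and ?w = "\<lambda>v x. sqrt (\<sigma> x) * v x"
  have um: "u \<in> borel_measurable (lebesgue_on \<Omega>)" using u by (simp add: Linf_def)
  have Bm: "B \<in> borel_measurable (lebesgue_on \<Omega>)" using B by (simp add: L2_def)
  have eL: "e \<in> L2 \<Omega>" and e0L: "e0 \<in> L2 \<Omega>"
    using e e0 by (auto simp: Hrot_def)
  have cle: "AE x in lebesgue_on \<Omega>. norm (?c x) \<le> ?U * norm (B x)"
    using Linf_norm_AE[OF u]
  proof eventually_elim
    case (elim x)
    then show ?case
      using abs_cross2_le[of "u x" "B x"] mult_right_mono[OF elim, of "norm (B x)"] by simp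
  qed
  have nth: "(\<lambda>x. f x $ i) \<in> borel_measurable (lebesgue_on \<Omega>)"
    if "f \<in> borel_measurable (lebesgue_on \<Omega>)" for f :: vector_field and i
    using that by (rule borel_measurable_continuous_on[rotated]) (intro continuous_intros)
  have "?c \<in> borel_measurable (lebesgue_on \<Omega>)"
    unfolding cross2_def by (intro borel_measurable_diff borel_measurable_times nth um Bm)
  then have cL: "?c \<in> L2 \<Omega>"
    using B cle by (rule L2_dominated)
  note wL = L2_sqrt_mult(1)[OF \<sigma> _ \<open>0 \<le> s\<close>]
  have c_bound: "(L2_norm \<Omega> (?w ?c))\<^sup>2 \<le> s * ?U\<^sup>2 * (L2_norm \<Omega> B)\<^sup>2"
  proof -
    have "AE x in lebesgue_on \<Omega>. norm (?w ?c x) \<le> (sqrt s * \<bar>?U\<bar>) * norm (B x)"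
      using cle \<sigma>(2)
    proof eventually_elim
      case (elim x)
      have "norm (?w ?c x) = \<bar>sqrt (\<sigma> x)\<bar> * norm (?c x)"
        by (simp add: abs_mult)
      also have "\<dots> \<le> sqrt s * (\<bar>?U\<bar> * norm (B x))"
        using elim mult_right_mono[OF abs_ge_self[of ?U] norm_ge_zero[of "B x"]]
        by (intro mult_mono) auto
      finally show ?case by (simp add: mult.assoc)
    qed
    then have "L2_norm \<Omega> (?w ?c) \<le> (sqrt s * \<bar>?U\<bar>) * L2_norm \<Omega> B"
      using \<open>0 \<le> s\<close> by (intro L2_norm_dominated wL cL B) auto
    then have "(L2_norm \<Omega> (?w ?c))\<^sup>2 \<le> ((sqrt s * \<bar>?U\<bar>) * L2_norm \<Omega> B)\<^sup>2"
      by (rule power_mono) (rule L2_norm_nonneg)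
    also have "\<dots> = s * ?U\<^sup>2 * (L2_norm \<Omega> B)\<^sup>2"
      using \<open>0 \<le> s\<close> by (simp add: power_mult_distrib)
    finally show ?thesis .
  qed
  have rot_sum: "L2_inner \<Omega> (weak_rot \<Omega> (\<lambda>x. e x + e0 x)) B = L2_inner \<Omega> ?r B + L2_inner \<Omega> ?q B"
  proof -
    have "L2_inner \<Omega> (weak_rot \<Omega> (\<lambda>x. e x + e0 x)) B = L2_inner \<Omega> (\<lambda>x. ?r x + ?q x) B"
      by (rule L2_inner_cong_AE[OF weak_rot_add(2)[OF \<Omega> e e0] weak_rot_L2[OF weak_rot_add(1)[OF \<Omega> e e0]]
            L2_add[OF weak_rot_L2[OF e] weak_rot_L2[OF e0]] B])
    also have "\<dots> = L2_inner \<Omega> ?r B + L2_inner \<Omega> ?q B"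
      by (rule L2_inner_add_left[OF weak_rot_L2[OF e] weak_rot_L2[OF e0] B])
    finally show ?thesis .
  qed
  have "L2_inner \<Omega> (\<lambda>x. \<sigma> x * e x) e = (L2_norm \<Omega> (?w e))\<^sup>2"
    unfolding L2_norm_squared by (rule L2_inner_split_weight[OF \<sigma> eL eL])
  \<comment> \<open>Young with c = 2: after division by 2 only half of the dissipation is used up.\<close>
  moreover have "- 4 * L2_inner \<Omega> (\<lambda>x. \<sigma> x * ?c x) e \<le> 4 * (L2_norm \<Omega> (?w ?c))\<^sup>2 + (L2_norm \<Omega> (?w e))\<^sup>2"
    unfolding L2_inner_split_weight[OF \<sigma> cL eL]
    using L2_Young[OF wL[OF cL] wL[OF eL], of 2] by simp
  moreover have "- 2 * L2_inner \<Omega> (\<lambda>x. \<sigma> x * e0 x) e \<le> (L2_norm \<Omega> (?w e0))\<^sup>2 + (L2_norm \<Omega> (?w e))\<^sup>2"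
    unfolding L2_inner_split_weight[OF \<sigma> e0L eL]
    using L2_Young[OF wL[OF e0L] wL[OF eL], of 1] by simp
  moreover have "- 2 * L2_inner \<Omega> ?q B \<le> (L2_norm \<Omega> ?q)\<^sup>2 + (L2_norm \<Omega> B)\<^sup>2"
    using L2_Young[OF weak_rot_L2[OF e0] B, of 1] by simp
  moreover have "(Hrot_weighted_norm \<sigma> \<Omega> e0)\<^sup>2 = (L2_norm \<Omega> (?w e0))\<^sup>2 + (L2_norm \<Omega> ?q)\<^sup>2"
    unfolding Hrot_weighted_norm_def by simp
  moreover have "(2 * s * ?U\<^sup>2 + 1) * (L2_norm \<Omega> B)\<^sup>2 = 2 * (s * ?U\<^sup>2 * (L2_norm \<Omega> B)\<^sup>2) + (L2_norm \<Omega> B)\<^sup>2"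
    by (simp add: algebra_simps)
  ultimately show ?thesis
    using faraday ohm rot_sum c_bound L2_inner_commute[of \<Omega> B ?r] by linarith
qed

section \<open>The weighted estimate in time\<close>

text \<open>
  Gronwall's argument: the derivative of \<open>exp (- K t) y t\<close> is \<open>exp (- K t) (D - K y)\<close>, which the
  hypothesis bounds; integrate. That \<open>F\<close> is nonnegative makes it absolutely integrable, so that it
  stays integrable after multiplication by the exponential.
\<close>

lemma integrating_factor_inequality:
  fixes y e F :: "real \<Rightarrow> real"
  assumes t: "t \<in> {0..T}"
    and ineq: "\<And>\<tau>. \<tau> \<in> {0..T} \<Longrightarrow> \<exists>D. (y has_real_derivative D) (at \<tau> within {0..T}) \<and>
        D + 1/2 * e \<tau> \<le> F \<tau> + K * y \<tau>"
    and e: "continuous_on {0..T} e" and F: "F integrable_on {0..T}" "\<And>\<tau>. 0 \<le> F \<tau>"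
  shows "exp (- K * t) * y t + 1/2 * integral {0..t} (\<lambda>\<tau>. exp (- K * \<tau>) * e \<tau>)
    \<le> integral {0..t} (\<lambda>\<tau>. exp (- K * \<tau>) * F \<tau>) + y 0"
proof -
  obtain D where D: "\<And>\<tau>. \<tau> \<in> {0..T} \<Longrightarrow> (y has_real_derivative D \<tau>) (at \<tau> within {0..T})"
    and le: "\<And>\<tau>. \<tau> \<in> {0..T} \<Longrightarrow> D \<tau> + 1/2 * e \<tau> \<le> F \<tau> + K * y \<tau>"
    using ineq by metis
  have sub: "{0..t} \<subseteq> {0..T}" using t by auto
  have cont: "continuous_on {0..t} (\<lambda>\<tau>. exp (- K * \<tau>))"
    by (intro continuous_intros)
  have lhs: "((\<lambda>\<tau>. exp (- K * \<tau>) * (D \<tau> - K * y \<tau>)) has_integral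
      exp (- K * t) * y t - exp (- K * 0) * y 0) {0..t}"
  proof (rule fundamental_theorem_of_calculus)
    fix \<tau> assume \<tau>: "\<tau> \<in> {0..t}"
    have "(y has_real_derivative D \<tau>) (at \<tau> within {0..t})"
      using D sub \<tau> by (blast intro: DERIV_subset)
    then have "((\<lambda>\<tau>. exp (- K * \<tau>) * y \<tau>) has_real_derivative exp (- K * \<tau>) * (D \<tau> - K * y \<tau>))
        (at \<tau> within {0..t})"
      by (auto intro!: derivative_eq_intros simp: algebra_simps)
    then show "((\<lambda>\<tau>. exp (- K * \<tau>) * y \<tau>) has_vector_derivative exp (- K * \<tau>) * (D \<tau> - K * y \<tau>))
        (at \<tau> within {0..t})"
      by (simp add: has_real_derivative_iff_has_vector_derivative)
  qed (use t in simp)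
  have eint: "(\<lambda>\<tau>. exp (- K * \<tau>) * e \<tau>) integrable_on {0..t}"
    using continuous_on_subset[OF e sub] by (intro integrable_continuous_real continuous_on_mult cont)
  have Fint: "(\<lambda>\<tau>. exp (- K * \<tau>) * F \<tau>) integrable_on {0..t}"
  proof -
    have "F integrable_on {0..t}"
      using F(1) sub by (rule integrable_subinterval_real)
    then have "F absolutely_integrable_on {0..t}"
      using F(2) by (intro nonnegative_absolutely_integrable_1)
    moreover have "(\<lambda>\<tau>. exp (- K * \<tau>)) \<in> borel_measurable (lebesgue_on {0..t})"
      using cont by (rule continuous_imp_measurable_on_sets_lebesgue) simp
    moreover have "bounded ((\<lambda>\<tau>. exp (- K * \<tau>)) ` {0..t})"
      using compact_continuous_image[OF cont] compact_imp_bounded by blast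
    ultimately have "(\<lambda>\<tau>. exp (- K * \<tau>) * F \<tau>) absolutely_integrable_on {0..t}"
      by (intro absolutely_integrable_bounded_measurable_product_real) auto
    then show ?thesis
      by (simp add: absolutely_integrable_on_def)
  qed
  have rhs: "((\<lambda>\<tau>. exp (- K * \<tau>) * F \<tau> - 1/2 * (exp (- K * \<tau>) * e \<tau>)) has_integral
      integral {0..t} (\<lambda>\<tau>. exp (- K * \<tau>) * F \<tau>) - 1/2 * integral {0..t} (\<lambda>\<tau>. exp (- K * \<tau>) * e \<tau>)) {0..t}"
    by (rule has_integral_diff[OF integrable_integral[OF Fint]
          has_integral_mult_right[OF integrable_integral[OF eint], of "1/2"]])
  have "exp (- K * t) * y t - exp (- K * 0) * y 0
      \<le> integral {0..t} (\<lambda>\<tau>. exp (- K * \<tau>) * F \<tau>) - 1/2 * integral {0..t} (\<lambda>\<tau>. exp (- K * \<tau>) * e \<tau>)"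
  proof (rule has_integral_le[OF lhs rhs])
    fix \<tau> assume "\<tau> \<in> {0..t}"
    then have "D \<tau> - K * y \<tau> \<le> F \<tau> - 1/2 * e \<tau>"
      using le[of \<tau>] sub by auto
    from mult_left_mono[OF this, of "exp (- K * \<tau>)"]
    show "exp (- K * \<tau>) * (D \<tau> - K * y \<tau>) \<le> exp (- K * \<tau>) * F \<tau> - 1/2 * (exp (- K * \<tau>) * e \<tau>)"
      by (simp add: algebra_simps)
  qed
  then show ?thesis by simp
qed

text \<open>
  Makes the dissipation integrable in time.
\<close>

lemma continuous_on_weighted_L2_norm_squared:
  assumes \<sigma>: "\<sigma> \<in> borel_measurable (lebesgue_on \<Omega>)" "AE x in lebesgue_on \<Omega>. 0 \<le> \<sigma> x \<and> \<sigma> x \<le> s" and "0 \<le> s"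
    and E: "C0_time T (Hrot0 \<Omega>) (Hrot_norm \<Omega>) E"
  shows "continuous_on {0..T} (\<lambda>t. (L2_norm \<Omega> (\<lambda>x. sqrt (\<sigma> x) * E t x))\<^sup>2)"
  unfolding continuous_on_def
proof
  fix t assume t: "t \<in> {0..T}"
  have EL: "E s \<in> L2 \<Omega>" if "s \<in> {0..T}" for s
    using E that by (auto simp: C0_time_def Hrot0_def Hrot_def)
  have ev: "\<forall>\<^sub>F s in at t within {0..T}. s \<in> {0..T}"
    by (simp add: eventually_at_filter)
  note wL = L2_sqrt_mult(1)[OF \<sigma> _ \<open>0 \<le> s\<close>]
  show "((\<lambda>t. (L2_norm \<Omega> (\<lambda>x. sqrt (\<sigma> x) * E t x))\<^sup>2) \<longlongrightarrow> (L2_norm \<Omega> (\<lambda>x. sqrt (\<sigma> x) * E t x))\<^sup>2)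
      (at t within {0..T})"
  proof (rule L2_tendsto_norm_squared)
    show "\<forall>\<^sub>F s in at t within {0..T}. (\<lambda>x. sqrt (\<sigma> x) * E s x) \<in> L2 \<Omega>"
      using ev by eventually_elim (intro wL EL)
    show "(\<lambda>x. sqrt (\<sigma> x) * E t x) \<in> L2 \<Omega>"
      by (intro wL EL t)
    have "((\<lambda>r. Hrot_norm \<Omega> (\<lambda>x. E r x - E t x)) \<longlongrightarrow> 0) (at t within {0..T})"
      using E t by (simp add: C0_time_def)
    then have "((\<lambda>r. L2_norm \<Omega> (\<lambda>x. E r x - E t x)) \<longlongrightarrow> 0) (at t within {0..T})"
      by (rule L2_norm_tendsto_0[where N="Hrot_norm \<Omega>"]) (rule L2_norm_le_Hrot_norm)
    then have lim: "((\<lambda>r. sqrt s * L2_norm \<Omega> (\<lambda>x. E r x - E t x)) \<longlongrightarrow> 0) (at t within {0..T})"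
      by (rule tendsto_mult_right_zero)
    have "\<forall>\<^sub>F r in at t within {0..T}. L2_norm \<Omega> (\<lambda>x. sqrt (\<sigma> x) * E r x - sqrt (\<sigma> x) * E t x)
        \<le> sqrt s * L2_norm \<Omega> (\<lambda>x. E r x - E t x)"
      using ev
    proof eventually_elim
      case (elim r)
      show ?case
        using L2_sqrt_mult(2)[OF \<sigma> L2_diff[OF EL[OF elim] EL[OF t]] \<open>0 \<le> s\<close>]
        by (simp only: right_diff_distrib)
    qed
    then show "((\<lambda>r. L2_norm \<Omega> (\<lambda>x. sqrt (\<sigma> x) * E r x - sqrt (\<sigma> x) * E t x)) \<longlongrightarrow> 0) (at t within {0..T})"
      by (rule tendsto_sandwich[OF always_eventually _ tendsto_const lim, rotated]) (simp add: L2_norm_nonneg)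
  qed
qed

theorem theorem5p1:
  fixes \<Omega> :: "(real^2) set" and T \<sigma>_lo \<sigma>_hi :: real
    and \<sigma> :: "real^2 \<Rightarrow> real" and u :: "real^2 \<Rightarrow> real^2"
  assumes "open \<Omega>" and "bounded \<Omega>" and "polygonal \<Omega>" and "0 < T"
    and "u \<in> Linf \<Omega>"
    and "\<sigma> \<in> borel_measurable (lebesgue_on \<Omega>)"
    and "0 < \<sigma>_lo" and "0 < \<sigma>_hi"
    and "AE x in lebesgue_on \<Omega>. \<sigma>_lo \<le> \<sigma> x \<and> \<sigma> x \<le> \<sigma>_hi"
  shows
    "(\<forall>E0 B0 B Ehat. is_solution \<Omega> T \<sigma> u E0 B0 B Ehat \<longrightarrow>
        (\<forall>t\<in>{0..T}. \<exists>D.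
           ((\<lambda>s. (L2_norm \<Omega> (B s))\<^sup>2) has_real_derivative D) (at t within {0..T}) \<and>
           D + 1/2 * (L2_norm \<Omega> (\<lambda>x. sqrt (\<sigma> x) * Ehat t x))\<^sup>2
             \<le> (Hrot_weighted_norm \<sigma> \<Omega> (E0 t))\<^sup>2
               + (2 * \<sigma>_hi * (Linf_norm \<Omega> u)\<^sup>2 + 1) * (L2_norm \<Omega> (B t))\<^sup>2 \<and>
           (1 \<le> \<sigma>_hi \<longrightarrow>
             D + 1/2 * (L2_norm \<Omega> (\<lambda>x. sqrt (\<sigma> x) * Ehat t x))\<^sup>2
               \<le> (Hrot_weighted_norm \<sigma> \<Omega> (E0 t))\<^sup>2
                 + (2 * \<sigma>_hi\<^sup>2 * (Linf_norm \<Omega> u)\<^sup>2 + 1) * (L2_norm \<Omega> (B t))\<^sup>2)))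
     \<and>
     (\<exists>\<beta> :: real \<Rightarrow> real.
        (\<forall>t\<in>{0..T}. 0 < \<beta> t) \<and> bounded (\<beta> ` {0..T}) \<and>
        \<beta> \<in> borel_measurable (lebesgue_on {0..T}) \<and>
        (\<forall>E0 B0 B Ehat. is_solution \<Omega> T \<sigma> u E0 B0 B Ehat \<longrightarrow>
           (\<lambda>\<tau>. (Hrot_weighted_norm \<sigma> \<Omega> (E0 \<tau>))\<^sup>2) integrable_on {0..T} \<longrightarrow>
           (\<forall>t\<in>{0..T}.
              \<beta> t * (L2_norm \<Omega> (B t))\<^sup>2
                + 1/2 * integral {0..t}
                    (\<lambda>\<tau>. \<beta> \<tau> * (L2_norm \<Omega> (\<lambda>x. sqrt (\<sigma> x) * Ehat \<tau> x))\<^sup>2)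
              \<le> integral {0..t} (\<lambda>\<tau>. \<beta> \<tau> * (Hrot_weighted_norm \<sigma> \<Omega> (E0 \<tau>))\<^sup>2)
                + (L2_norm \<Omega> B0)\<^sup>2)))"
proof -
  let ?U = "Linf_norm \<Omega> u"
  define K where "K = 2 * \<sigma>_hi * ?U\<^sup>2 + 1"
  have \<sigma>: "AE x in lebesgue_on \<Omega>. 0 \<le> \<sigma> x \<and> \<sigma> x \<le> \<sigma>_hi"
    using assms(9) by eventually_elim (use assms(7) in auto)
  have pos: "0 \<le> \<sigma>_hi" using assms(8) by simp
  have energy: "\<exists>D. ((\<lambda>s. (L2_norm \<Omega> (B s))\<^sup>2) has_real_derivative D) (at t within {0..T}) \<and>
      D + 1/2 * (L2_norm \<Omega> (\<lambda>x. sqrt (\<sigma> x) * Ehat t x))\<^sup>2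
        \<le> (Hrot_weighted_norm \<sigma> \<Omega> (E0 t))\<^sup>2 + K * (L2_norm \<Omega> (B t))\<^sup>2"
    if sol: "is_solution \<Omega> T \<sigma> u E0 B0 B Ehat" and t: "t \<in> {0..T}" for E0 B0 B Ehat t
  proof -
    obtain B' where B': "C1_time T (Hdiv \<Omega>) (Hdiv_norm \<Omega>) B B'"
      and faraday: "\<forall>t\<in>{0..T}. \<forall>w\<in>Hdiv \<Omega>.
           L2_inner \<Omega> (B' t) w + L2_inner \<Omega> (weak_rot \<Omega> (\<lambda>x. Ehat t x + E0 t x)) w = 0"
      using sol unfolding is_solution_def by blast
    have Bt: "B t \<in> Hdiv \<Omega>"
      using B' t by (simp add: C1_time_def C0_time_def)
    have Et: "Ehat t \<in> Hrot0 \<Omega>" and E0t: "E0 t \<in> Hrot \<Omega>"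
      using sol t by (simp_all add: is_solution_def C0_time_def)
    have "2 * L2_inner \<Omega> (B' t) (B t) + 1/2 * (L2_norm \<Omega> (\<lambda>x. sqrt (\<sigma> x) * Ehat t x))\<^sup>2
        \<le> (Hrot_weighted_norm \<sigma> \<Omega> (E0 t))\<^sup>2 + K * (L2_norm \<Omega> (B t))\<^sup>2"
      unfolding K_def
    proof (rule energy_inequality[OF assms(1,2,5,6) \<sigma> pos])
      show "B t \<in> L2 \<Omega>" using Bt by (simp add: Hdiv_def)
      show "Ehat t \<in> Hrot \<Omega>" using Et by (simp add: Hrot0_def)
      show "E0 t \<in> Hrot \<Omega>" by (rule E0t)
      show "L2_inner \<Omega> (B' t) (B t) + L2_inner \<Omega> (weak_rot \<Omega> (\<lambda>x. Ehat t x + E0 t x)) (B t) = 0"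
        using faraday t Bt by blast
      show "L2_inner \<Omega> (\<lambda>x. \<sigma> x * Ehat t x) (Ehat t)
          + L2_inner \<Omega> (\<lambda>x. \<sigma> x * cross2 (u x) (B t x)) (Ehat t)
          - L2_inner \<Omega> (B t) (weak_rot \<Omega> (Ehat t)) = - L2_inner \<Omega> (\<lambda>x. \<sigma> x * E0 t x) (Ehat t)"
        using sol t Et unfolding is_solution_def by blast
    qed
    with has_derivative_L2_norm_squared_C1_time[OF B' t] show ?thesis by blast
  qed
  show ?thesis
  proof (intro conjI allI impI ballI)
    fix E0 B0 B Ehat t assume sol: "is_solution \<Omega> T \<sigma> u E0 B0 B Ehat" and t: "t \<in> {0..T}"
    obtain D where D: "((\<lambda>s. (L2_norm \<Omega> (B s))\<^sup>2) has_real_derivative D) (at t within {0..T})"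
      "D + 1/2 * (L2_norm \<Omega> (\<lambda>x. sqrt (\<sigma> x) * Ehat t x))\<^sup>2
        \<le> (Hrot_weighted_norm \<sigma> \<Omega> (E0 t))\<^sup>2 + K * (L2_norm \<Omega> (B t))\<^sup>2"
      using energy[OF sol t] by blast
    have K_le: "K * (L2_norm \<Omega> (B t))\<^sup>2 \<le> (2 * \<sigma>_hi\<^sup>2 * ?U\<^sup>2 + 1) * (L2_norm \<Omega> (B t))\<^sup>2" if "1 \<le> \<sigma>_hi"
      unfolding K_def using self_le_power[OF that, of 2]
      by (intro mult_right_mono add_right_mono) auto
    show "\<exists>D. ((\<lambda>s. (L2_norm \<Omega> (B s))\<^sup>2) has_real_derivative D) (at t within {0..T}) \<and>
           D + 1/2 * (L2_norm \<Omega> (\<lambda>x. sqrt (\<sigma> x) * Ehat t x))\<^sup>2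
             \<le> (Hrot_weighted_norm \<sigma> \<Omega> (E0 t))\<^sup>2
               + (2 * \<sigma>_hi * ?U\<^sup>2 + 1) * (L2_norm \<Omega> (B t))\<^sup>2 \<and>
           (1 \<le> \<sigma>_hi \<longrightarrow>
             D + 1/2 * (L2_norm \<Omega> (\<lambda>x. sqrt (\<sigma> x) * Ehat t x))\<^sup>2
               \<le> (Hrot_weighted_norm \<sigma> \<Omega> (E0 t))\<^sup>2
                 + (2 * \<sigma>_hi\<^sup>2 * ?U\<^sup>2 + 1) * (L2_norm \<Omega> (B t))\<^sup>2)"
      by (intro exI[of _ D] conjI impI D(1) D(2)[unfolded K_def] order_trans[OF D(2) add_left_mono[OF K_le]])
  next
    let ?\<beta> = "\<lambda>t. exp (- K * t)"
    have cont: "continuous_on {0..T} ?\<beta>" by (intro continuous_intros)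
    have "?\<beta> \<in> borel_measurable (lebesgue_on {0..T})"
      using cont by (rule continuous_imp_measurable_on_sets_lebesgue) simp
    moreover have "bounded (?\<beta> ` {0..T})"
      using compact_continuous_image[OF cont] compact_imp_bounded by blast
    moreover have "?\<beta> t * (L2_norm \<Omega> (B t))\<^sup>2
          + 1/2 * integral {0..t} (\<lambda>\<tau>. ?\<beta> \<tau> * (L2_norm \<Omega> (\<lambda>x. sqrt (\<sigma> x) * Ehat \<tau> x))\<^sup>2)
        \<le> integral {0..t} (\<lambda>\<tau>. ?\<beta> \<tau> * (Hrot_weighted_norm \<sigma> \<Omega> (E0 \<tau>))\<^sup>2) + (L2_norm \<Omega> B0)\<^sup>2"
      if sol: "is_solution \<Omega> T \<sigma> u E0 B0 B Ehat"
        and F: "(\<lambda>\<tau>. (Hrot_weighted_norm \<sigma> \<Omega> (E0 \<tau>))\<^sup>2) integrable_on {0..T}"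
        and t: "t \<in> {0..T}" for E0 B0 B Ehat t
    proof -
      have "C0_time T (Hrot0 \<Omega>) (Hrot_norm \<Omega>) Ehat"
        using sol by (simp add: is_solution_def)
      then have "continuous_on {0..T} (\<lambda>t. (L2_norm \<Omega> (\<lambda>x. sqrt (\<sigma> x) * Ehat t x))\<^sup>2)"
        by (rule continuous_on_weighted_L2_norm_squared[OF assms(6) \<sigma> pos])
      note est = integrating_factor_inequality[OF t energy[OF sol] this F zero_le_power2]
      have "B 0 \<in> L2 \<Omega>"
        using sol \<open>0 < T\<close> by (auto simp: is_solution_def C1_time_def C0_time_def Hdiv_def)
      then have "L2_norm \<Omega> (B 0) = L2_norm \<Omega> B0"
        using sol by (intro L2_norm_cong_AE assms(1)) (simp_all add: is_solution_def)
      with est show ?thesis by simp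
    qed
    ultimately show "\<exists>\<beta> :: real \<Rightarrow> real.
        (\<forall>t\<in>{0..T}. 0 < \<beta> t) \<and> bounded (\<beta> ` {0..T}) \<and>
        \<beta> \<in> borel_measurable (lebesgue_on {0..T}) \<and>
        (\<forall>E0 B0 B Ehat. is_solution \<Omega> T \<sigma> u E0 B0 B Ehat \<longrightarrow>
           (\<lambda>\<tau>. (Hrot_weighted_norm \<sigma> \<Omega> (E0 \<tau>))\<^sup>2) integrable_on {0..T} \<longrightarrow>
           (\<forall>t\<in>{0..T}.
              \<beta> t * (L2_norm \<Omega> (B t))\<^sup>2
                + 1/2 * integral {0..t}
                    (\<lambda>\<tau>. \<beta> \<tau> * (L2_norm \<Omega> (\<lambda>x. sqrt (\<sigma> x) * Ehat \<tau> x))\<^sup>2)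
              \<le> integral {0..t} (\<lambda>\<tau>. \<beta> \<tau> * (Hrot_weighted_norm \<sigma> \<Omega> (E0 \<tau>))\<^sup>2)
                + (L2_norm \<Omega> B0)\<^sup>2))"
      by (intro exI[of _ ?\<beta>] conjI ballI allI impI) simp_all
  qed
qed

end
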